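(* Assume $|B|<m$ and $A\not\subseteq B$, and let $\mathcal S_3=\{(w_1+uw_2,w_3)\in\mathcal R^m: w_1\in\Delta_A,\ w_2\in\Delta_B^c,\ w_3\in\Delta_C\}$. Then $\Phi(\mathscr C_{\mathcal S_3})$ is a linear code over $\mathbb F_q$ with parameters $\big[2q^{|A|+|C|}(q^m-q^{|B|}),\ m+|A|+|C|,\ 2(q-1)q^{|A|+|C|-1}(q^m-q^{|B|})\big]$ and nonzero Hamming weights: $2(q-1)q^{|A|+|C|-1}(q^m-q^{|B|})$ with frequency $q^{m+|A|+|C|}-2q^{m-|B|}+q^{m-|A\cup B|}$; $(q-1)q^{|A|+|C|-1}(2q^m-q^{|B|})$ with frequency $2(q^{m-|B|}-q^{m-|A\cup B|})$; $2(q-1)q^{m+|A|+|C|-1}$ with frequency $q^{m-|A\cup B|}-1$. Furthermore, $\Phi(\mathscr C_{\mathcal S_3})$ is minimal, near-Griesmer and distance-optimal; it is self-orthogonal if $q\in\{2,3\}$; and it is a $2$-weight code if $A\cup B=[m]$ and a $3$-weight code otherwise.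
   Context: Let $q$ be a prime power, $\mathbb F_q$ the field of order $q$, $m\ge 2$ an integer and $[m]=\{1,\dots,m\}$. For $v\in\mathbb F_q^m$, $\mathrm{supp}(v)=\{i:v_i\ne0\}$. For nonempty $P\subseteq[m]$, $\Delta_P=\{v\in\mathbb F_q^m:\mathrm{supp}(v)\subseteq P\}$, $\Delta_P^c=\mathbb F_q^m\setminus\Delta_P$. $A,B,C$ denote nonempty subsets of $[m]$. Let $R=\mathbb F_q[u]/\langle u^2\rangle$ and $\mathcal R=R\times\mathbb F_q$; each element of $\mathcal R^m$ is uniquely $(d+ue,f)$ with $d,e,f\in\mathbb F_q^m$. Define $\langle(d_1+ue_1,f_1),(d_2+ue_2,f_2)\rangle=(d_1+ue_1)\cdot(d_2+ue_2)+u\,f_1\cdot f_2\in R$, where $x\cdot y=\sum_i x_iy_i$. For a nonempty $\mathcal D\subseteq\mathcal R^m$ listed in a fixed order, $\mathscr C_{\mathcal D}=\{(\langle r,s\rangle)_{s\in\mathcal D}: r\in\mathcal R^m\}\subseteq R^{|\mathcal D|}$. The Gray map $\Phi:R^n\to\mathbb F_q^{2n}$ is $\Phi(d+ue)=(e,d+e)$, applied to codes elementwise. An $[n,k,d]$ code is a linear code over $\mathbb F_q$ of length $n$, dimension $k$, minimum Hamming distance $d$. It is distance-optimal if no linear $[n,k,d+1]$ code over $\mathbb F_q$ exists; near-Griesmer if $\sum_{i=0}^{k-1}\lceil d/q^i\rceil=n-1$; minimal if whenever $\mathrm{supp}(c')\subseteq\mathrm{supp}(c)$ for codewords $c,c'$,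 then $c'=\alpha c$ for some $\alpha\in\mathbb F_q$; self-orthogonal if $\mathcal C\subseteq\mathcal C^\perp$ (Euclidean). *)

theory Defs
  imports Complex_Main "HOL-Library.Function_Algebras" "HOL-Library.Cardinality"
begin

section \<open>Vectors over F_q indexed by a finite type 'n (so [m] = UNIV, m = CARD('n))\<close>

definition dotp :: "('n::finite \<Rightarrow> 'a::field) \<Rightarrow> ('n \<Rightarrow> 'a) \<Rightarrow> 'a" where
  "dotp x y = (\<Sum>i\<in>UNIV. x i * y i)"

definition supp :: "('n \<Rightarrow> 'a::zero) \<Rightarrow> 'n set" where
  "supp v = {i. v i \<noteq> 0}"

definition Delta :: "'n set \<Rightarrow> ('n \<Rightarrow> 'a::zero) set" where
  "Delta P = {v. supp v \<subseteq> P}"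

definition DeltaC :: "'n set \<Rightarrow> ('n \<Rightarrow> 'a::zero) set" where
  "DeltaC P = UNIV - Delta P"

section \<open>The ring R = F_q[u]/<u^2>: an element d + u e is the pair (d, e)\<close>

definition radd :: "'a::field \<times> 'a \<Rightarrow> 'a \<times> 'a \<Rightarrow> 'a \<times> 'a" where
  "radd x y = (fst x + fst y, snd x + snd y)"

definition rmul :: "'a::field \<times> 'a \<Rightarrow> 'a \<times> 'a \<Rightarrow> 'a \<times> 'a" where
  "rmul x y = (fst x * fst y, fst x * snd y + snd x * fst y)"

definition ru :: "'a::field \<times> 'a" where "ru = (0, 1)"

definition rsum :: "('i \<Rightarrow> 'a::field \<times> 'a) \<Rightarrow> 'i set \<Rightarrow> 'a \<times> 'a" where
  "rsum f S = (\<Sum>i\<in>S. fst (f i), \<Sum>i\<in>S. snd (f i))"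

text \<open>Dot product on R^m; a vector d + u e of R^m is the pair of F_q-vectors (d, e).\<close>
definition rdot :: "('n::finite \<Rightarrow> 'a::field) \<times> ('n \<Rightarrow> 'a) \<Rightarrow> ('n \<Rightarrow> 'a) \<times> ('n \<Rightarrow> 'a) \<Rightarrow> 'a \<times> 'a" where
  "rdot x y = rsum (\<lambda>i. rmul (fst x i, snd x i) (fst y i, snd y i)) UNIV"

section \<open>The ring \<R> = R x F_q; an element (d + u e, f) of \<R>^m is the triple (d, e, f)\<close>

type_synonym ('n, 'a) Rvec = "('n \<Rightarrow> 'a) \<times> ('n \<Rightarrow> 'a) \<times> ('n \<Rightarrow> 'a)"

definition Rinner :: "('n::finite, 'a::field) Rvec \<Rightarrow> ('n, 'a) Rvec \<Rightarrow> 'a \<times> 'a" where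
  "Rinner x y = (case x of (d1, e1, f1) \<Rightarrow> case y of (d2, e2, f2) \<Rightarrow>
      radd (rdot (d1, e1) (d2, e2)) (rmul ru (dotp f1 f2, 0)))"

text \<open>The code C_D over R for D listed (without repetition) as the list ds;
  a codeword of length n = length ds is a function nat => R vanishing from position n on.\<close>
definition codeD :: "('n::finite, 'a::field) Rvec list \<Rightarrow> (nat \<Rightarrow> 'a \<times> 'a) set" where
  "codeD ds = {(\<lambda>j. if j < length ds then Rinner r (ds ! j) else (0, 0)) | r. True}"

text \<open>Gray map Phi : R^n -> F_q^(2n), Phi(d + u e) = (e, d + e), for words of length n.\<close>
definition gray :: "nat \<Rightarrow> (nat \<Rightarrow> 'a::field \<times> 'a) \<Rightarrow> (nat \<Rightarrow> 'a)" where
  "gray n c = (\<lambda>j. if j < n then snd (c j)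
                   else if j < 2 * n then fst (c (j - n)) + snd (c (j - n)) else 0)"

section \<open>Linear codes over F_q: words of length n are functions nat => F_q vanishing from n on\<close>

definition fscale :: "'a::field \<Rightarrow> (nat \<Rightarrow> 'a) \<Rightarrow> (nat \<Rightarrow> 'a)" where
  "fscale c v = (\<lambda>j. c * v j)"

definition lincode :: "nat \<Rightarrow> (nat \<Rightarrow> 'a::field) set \<Rightarrow> bool" where
  "lincode n C \<longleftrightarrow> C \<subseteq> {v. \<forall>j\<ge>n. v j = 0} \<and> 0 \<in> C \<and>
     (\<forall>x\<in>C. \<forall>y\<in>C. x + y \<in> C) \<and> (\<forall>c. \<forall>x\<in>C. fscale c x \<in> C)"

definition cdim :: "(nat \<Rightarrow> 'a::field) set \<Rightarrow> nat" where
  "cdim C = vector_space.dim fscale C"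

definition hwt :: "(nat \<Rightarrow> 'a::zero) \<Rightarrow> nat" where
  "hwt v = card {j. v j \<noteq> 0}"

definition hdist :: "(nat \<Rightarrow> 'a) \<Rightarrow> (nat \<Rightarrow> 'a) \<Rightarrow> nat" where
  "hdist x y = card {j. x j \<noteq> y j}"

definition mindist :: "(nat \<Rightarrow> 'a) set \<Rightarrow> nat" where
  "mindist C = Inf {hdist x y | x y. x \<in> C \<and> y \<in> C \<and> x \<noteq> y}"

definition is_code :: "nat \<Rightarrow> nat \<Rightarrow> nat \<Rightarrow> (nat \<Rightarrow> 'a::field) set \<Rightarrow> bool" where
  "is_code n k d C \<longleftrightarrow> lincode n C \<and> cdim C = k \<and> mindist C = d"

definition distance_optimal :: "nat \<Rightarrow> nat \<Rightarrow> nat \<Rightarrow> (nat \<Rightarrow> 'a::field) set \<Rightarrow> bool" where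
  "distance_optimal n k d C \<longleftrightarrow> \<not> (\<exists>C' :: (nat \<Rightarrow> 'a) set. is_code n k (d + 1) C')"

definition near_griesmer :: "nat \<Rightarrow> nat \<Rightarrow> nat \<Rightarrow> nat \<Rightarrow> bool" where
  "near_griesmer q n k d \<longleftrightarrow> (\<Sum>i<k. nat \<lceil>real d / real q ^ i\<rceil>) = n - 1"

definition minimal_code :: "(nat \<Rightarrow> 'a::field) set \<Rightarrow> bool" where
  "minimal_code C \<longleftrightarrow> (\<forall>c\<in>C. \<forall>c'\<in>C. {j. c' j \<noteq> 0} \<subseteq> {j. c j \<noteq> 0} \<longrightarrow> (\<exists>\<alpha>. c' = fscale \<alpha> c))"

definition self_orthogonal :: "nat \<Rightarrow> (nat \<Rightarrow> 'a::field) set \<Rightarrow> bool" where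
  "self_orthogonal n C \<longleftrightarrow> (\<forall>x\<in>C. \<forall>y\<in>C. (\<Sum>j<n. x j * y j) = 0)"

definition nonzero_weights :: "(nat \<Rightarrow> 'a::zero) set \<Rightarrow> nat set" where
  "nonzero_weights C = {hwt c | c. c \<in> C \<and> c \<noteq> 0}"

definition wfreq :: "(nat \<Rightarrow> 'a::zero) set \<Rightarrow> nat \<Rightarrow> nat" where
  "wfreq C w = card {c \<in> C. c \<noteq> 0 \<and> hwt c = w}"

end

theory Submission
  imports Defs "HOL-Library.FuncSet" "HOL-Library.Product_Plus"
begin

text \<open>Both halves of a Gray image are evaluations of a linear form
  \<open>w \<mapsto> y \<bullet> w1 + x \<bullet> w2 + z \<bullet> w3\<close> on the defining set, which is the linear space
  \<open>Delta A \<times> UNIV \<times> Delta C\<close> with the subspace \<open>Delta A \<times> Delta B \<times> Delta C\<close> removed; in the second half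
  \<open>y\<close> is replaced by \<open>x + y\<close>. A linear form on a finite space is zero or takes every value equally
  often, so a weight only depends on which of the two forms vanish on the removed subspace.
  Minimality is the Ashikhmin-Barg criterion. A code of distance \<open>d + 1\<close> is excluded by the
  Griesmer bound, since \<open>d\<close> is divisible by a high power of \<open>q\<close> and so raising it by one raises many
  terms of the Griesmer sum. Self-orthogonality follows from divisibility of all weights by 4
  (\<open>q = 2\<close>) or by 3 (\<open>q = 3\<close>).\<close>

section \<open>Linear codes over a finite field\<close>

text \<open>All nonempty fibres are translates of the kernel. A set \<open>D\<close> closed under
  sum and difference replaces a whole type, so that the count applies both to a code and to a
  product of spaces \<open>Delta P\<close>.\<close>

lemma card_image_kernel:
  fixes f :: "'v::ab_group_add \<Rightarrow> 'w::ab_group_add"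
  assumes fin: "finite D" and add: "\<And>x y. x \<in> D \<Longrightarrow> y \<in> D \<Longrightarrow> x + y \<in> D"
    and diff: "\<And>x y. x \<in> D \<Longrightarrow> y \<in> D \<Longrightarrow> x - y \<in> D"
    and f: "\<And>x y. x \<in> D \<Longrightarrow> y \<in> D \<Longrightarrow> f (x + y) = f x + f y"
  shows "card D = card (f ` D) * card {x \<in> D. f x = 0}"
proof -
  have fd: "f (x - y) = f x - f y" if "x \<in> D" "y \<in> D" for x y
    using f[OF diff[OF that] that(2)] by (simp add: algebra_simps)
  have fib: "card {x \<in> D. f x = t} = card {x \<in> D. f x = 0}" if "t \<in> f ` D" for t
  proof -
    from that obtain w where w: "w \<in> D" "f w = t" by auto
    have "bij_betw (\<lambda>x. x - w) {x \<in> D. f x = t} {x \<in> D. f x = 0}"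
      by (rule bij_betw_byWitness[where f' = "\<lambda>x. x + w"])
        (use w f fd add diff in \<open>auto\<close>)
    then show ?thesis by (rule bij_betw_same_card)
  qed
  have "card D = (\<Sum>t\<in>f ` D. card {x \<in> D. f x = t})"
    using sum.group[OF fin finite_imageI[OF fin, of f] order_refl, where h = "\<lambda>_. 1::nat"] by simp
  also have "\<dots> = card (f ` D) * card {x \<in> D. f x = 0}"
    using fib by simp
  finally show ?thesis .
qed

lemma card_field_ge2: "2 \<le> CARD('a::{field,finite})"
proof -
  have "card {0, 1::'a} \<le> CARD('a)" by (rule card_mono) auto
  then show ?thesis by simp
qed

lemma vector_space_fscale: "vector_space (fscale :: 'a::field \<Rightarrow> _)"
  by unfold_locales (auto simp: fscale_def fun_eq_iff algebra_simps)

text \<open>Adjoining a vector \<open>x\<close> outside the span multiplies the size by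
  \<open>q\<close>, because the representation \<open>fscale a x + s\<close> is unique.\<close>

lemma card_span_independent:
  fixes S :: "(nat \<Rightarrow> 'a::{field,finite}) set"
  assumes "finite S" "\<not> module.dependent fscale S"
  shows "card (module.span fscale S) = CARD('a) ^ card S \<and> finite (module.span fscale S)"
proof -
  interpret vector_space "fscale :: 'a \<Rightarrow> _" by (rule vector_space_fscale)
  show ?thesis using assms
  proof (induction S rule: finite_induct)
    case empty
    then show ?case by simp
  next
    case (insert x S)
    have ind: "independent S" and x: "x \<notin> span S"
      using insert by (simp_all add: independent_insert)
    have eq: "span (insert x S) = (\<lambda>(a, s). fscale a x + s) ` (UNIV \<times> span S)"
      unfolding span_insert
      by (auto simp: image_iff) (metis add.commute diff_add_cancel, metis add_diff_cancel_left')
    have inj: "inj_on (\<lambda>(a, s). fscale a x + s) (UNIV \<times> span S)"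
    proof (clarsimp simp: inj_on_def)
      fix a s b t assume st: "s \<in> span S" "t \<in> span S" and e: "fscale a x + s = fscale b x + t"
      have "fscale (a - b) x = t - s"
        using e by (auto simp: fscale_def fun_eq_iff algebra_simps)
      then have "fscale (a - b) x \<in> span S" using st by (simp add: span_diff)
      \<comment> \<open>Dividing by a nonzero \<open>a - b\<close> would put \<open>x\<close> itself
        into \<open>span S\<close>.\<close>
      then have "fscale (inverse (a - b)) (fscale (a - b) x) \<in> span S" by (rule span_scale)
      then have "a - b = 0" using x by (cases "a - b = 0") (auto simp: scale_scale simp del: right_minus_eq)
      then show "a = b \<and> s = t" using e by simp
    qed
    show ?case
      unfolding eq using insert ind by (simp add: card_image[OF inj] card_cartesian_product)
  qed
qed

lemma finite_words: "finite {v :: 'i \<Rightarrow> 'a::{zero,finite}. supp v \<subseteq> J}" if "finite J"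
proof -
  have "{v :: 'i \<Rightarrow> 'a. supp v \<subseteq> J} = {v. (\<forall>i\<in>J. v i \<in> UNIV) \<and> (\<forall>i. i \<notin> J \<longrightarrow> v i = 0)}"
    by (auto simp: supp_def)
  then show ?thesis using finite_set_of_finite_funs[OF that, of "UNIV :: 'a set" 0] by simp
qed

lemma supp_lincode:
  assumes "lincode n C" "v \<in> C"
  shows "supp v \<subseteq> {..<n}"
proof -
  have "\<forall>j\<ge>n. v j = 0" using assms unfolding lincode_def by blast
  then show ?thesis by (auto simp: supp_def not_le[symmetric])
qed

text \<open>Every later use of the dimension goes through this count: it turns the number of
  codewords into \<open>cdim\<close>, and the dimension of a hypothetical better code into its
  size.\<close>

lemma card_lincode:
  fixes C :: "(nat \<Rightarrow> 'a::{field,finite}) set"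
  assumes "lincode n C"
  shows "card C = CARD('a) ^ cdim C"
proof -
  interpret vector_space "fscale :: 'a \<Rightarrow> _" by (rule vector_space_fscale)
  have "C \<subseteq> {v. supp v \<subseteq> {..<n}}" using supp_lincode[OF assms] by blast
  then have fin: "finite C" by (rule finite_subset) (simp add: finite_words)
  have sub: "subspace C"
    using assms by (simp add: lincode_def subspace_def)
  obtain S where S: "S \<subseteq> C" "independent S" "C \<subseteq> span S" "card S = dim C"
    using basis_exists by blast
  have "span S = C" using S sub by (metis span_subspace)
  then show ?thesis
    using card_span_independent[of S] S finite_subset[OF S(1) fin] by (simp add: cdim_def)
qed

section \<open>Averaging over multiples of a codeword: the Griesmer bound and minimality\<close>

lemma hwt_eq_card_supp: "hwt v = card (supp v)"
  by (simp add: hwt_def supp_def)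

text \<open>Double counting by coordinate: where \<open>c\<close> vanishes and \<open>v\<close> does
  not, all \<open>q\<close> choices of \<alpha> count; where \<open>c j\<close> is nonzero, only
  \<open>v j / c j\<close> fails to count.\<close>

lemma sum_card_supp_pencil:
  fixes c v :: "'i \<Rightarrow> 'a::{field,finite}"
  assumes J: "finite J" and c: "supp c \<subseteq> J" and v: "supp v \<subseteq> J"
  shows "(\<Sum>\<alpha>\<in>UNIV. card (supp (\<lambda>j. v j - \<alpha> * c j)))
    = CARD('a) * card (supp v - supp c) + (CARD('a) - 1) * card (supp c)"
proof -
  have out: "c j = 0 \<and> v j = 0" if "j \<notin> J" for j using that c v by (auto simp: supp_def)
  have "card (supp (\<lambda>j. v j - \<alpha> * c j)) = (\<Sum>j\<in>J. of_bool (v j \<noteq> \<alpha> * c j))" for \<alpha>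
  proof -
    have "supp (\<lambda>j. v j - \<alpha> * c j) = {j \<in> J. v j \<noteq> \<alpha> * c j}"
      using out by (auto simp: supp_def) (metis mult_zero_right)
    then show ?thesis using J by (simp add: sum_of_bool_eq Int_def)
  qed
  then have "(\<Sum>\<alpha>\<in>UNIV. card (supp (\<lambda>j. v j - \<alpha> * c j)))
      = (\<Sum>j\<in>J. \<Sum>\<alpha>\<in>UNIV. of_bool (v j \<noteq> \<alpha> * c j))"
    by (subst sum.swap) simp
  also have "\<dots> = (\<Sum>j\<in>J. CARD('a) * of_bool (j \<in> supp v - supp c)
      + (CARD('a) - 1) * of_bool (j \<in> supp c))"
  proof (rule sum.cong[OF refl])
    fix j assume "j \<in> J"
    show "(\<Sum>\<alpha>\<in>UNIV. of_bool (v j \<noteq> \<alpha> * c j)) = CARD('a) * of_bool (j \<in> supp v - supp c)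
      + (CARD('a) - 1) * of_bool (j \<in> supp c)"
    proof (cases "c j = 0")
      case True then show ?thesis by (simp add: supp_def)
    next
      case False
      then have "{\<alpha>. v j \<noteq> \<alpha> * c j} = UNIV - {v j / c j}" by (auto simp: field_simps)
      then have "card {\<alpha>. v j \<noteq> \<alpha> * c j} = CARD('a) - 1" by (simp add: card_Diff_singleton)
      then show ?thesis using False by (simp add: supp_def sum_of_bool_eq)
    qed
  qed
  also have "\<dots> = CARD('a) * card (supp v - supp c) + (CARD('a) - 1) * card (supp c)"
  proof -
    have "J \<inter> (supp v - supp c) = supp v - supp c" "J \<inter> supp c = supp c" using c v by auto
    moreover have "J \<inter> {j \<in> supp v. j \<notin> supp c} = J \<inter> (supp v - supp c)" by auto
    ultimately show ?thesis using J
      by (simp add: sum.distrib sum_distrib_left[symmetric] sum_of_bool_eq)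
  qed
  finally show ?thesis .
qed

text \<open>Induction on the dimension through the residual code with respect to a nonzero word
  \<open>c\<close> of least weight. The index set \<open>J\<close> is arbitrary, so the residual
  code on \<open>J - supp c\<close> is again an instance without renumbering, and \<open>d\<close>
  is real, so the induction can pass to \<open>d / q\<close> without rounding.\<close>

theorem griesmer_bound:
  fixes V :: "('i \<Rightarrow> 'a::{field,finite}) set" and d :: real
  assumes "finite J" and "\<And>v. v \<in> V \<Longrightarrow> supp v \<subseteq> J"
    and "\<And>x y. x \<in> V \<Longrightarrow> y \<in> V \<Longrightarrow> x + y \<in> V"
    and "\<And>\<alpha> x. x \<in> V \<Longrightarrow> (\<lambda>j. \<alpha> * x j) \<in> V"
    and "card V = CARD('a) ^ k"
    and "\<And>v. v \<in> V \<Longrightarrow> v \<noteq> 0 \<Longrightarrow> d \<le> real (card (supp v))"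
  shows "(\<Sum>i<k. nat \<lceil>d / real CARD('a) ^ i\<rceil>) \<le> card J"
  using assms
proof (induction k arbitrary: J V d)
  case 0
  then show ?case by simp
next
  case (Suc k)
  let ?q = "CARD('a)"
  have q2: "?q \<ge> 2" by (rule card_field_ge2)
  note sJ = Suc.prems(2) and add = Suc.prems(3) and scl = Suc.prems(4)
  have diff: "(\<lambda>j. v j - \<alpha> * c j) \<in> V" if "v \<in> V" "c \<in> V" for v c \<alpha>
  proof -
    have "v + (\<lambda>j. (- \<alpha>) * c j) \<in> V" using that add scl by blast
    moreover have "v + (\<lambda>j. (- \<alpha>) * c j) = (\<lambda>j. v j - \<alpha> * c j)" by (auto simp: fun_eq_iff)
    ultimately show ?thesis by simp
  qed
  have diff1: "x - y \<in> V" if "x \<in> V" "y \<in> V" for x y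
    using diff[OF that, of 1] by (simp add: fun_diff_def)
  have "card V > 1" using Suc.prems(5) q2 one_less_power[of ?q "Suc k"] by simp
  then have finV: "finite V" using card.infinite by fastforce
  have "V \<noteq> {} \<and> \<not> V \<subseteq> {0}" using \<open>card V > 1\<close> card_mono[of "{0}" V] by fastforce
  then obtain v0 where "v0 \<in> V \<and> v0 \<noteq> 0" by blast
  then obtain c where c: "c \<in> V" "c \<noteq> 0"
    and cmin: "\<And>v. v \<in> V \<Longrightarrow> v \<noteq> 0 \<Longrightarrow> card (supp c) \<le> card (supp v)"
    using arg_min_natI[of "\<lambda>v. v \<in> V \<and> v \<noteq> 0" v0 "\<lambda>v. card (supp v)"]
      arg_min_nat_le[of "\<lambda>v. v \<in> V \<and> v \<noteq> 0" _ "\<lambda>v. card (supp v)"] by blast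
  let ?w = "card (supp c)"
  have fs: "finite (supp v)" if "v \<in> V" for v using sJ[OF that] Suc.prems(1) finite_subset by blast
  have w0: "?w > 0" using c fs[OF c(1)] by (auto simp: card_gt_0_iff supp_def fun_eq_iff)
  \<comment> \<open>averaging the weights of \<open>v - \<alpha> c\<close> over \<open>\<alpha>\<close>\<close>
  have res: "?w \<le> ?q * card (supp v - supp c)" if v: "v \<in> V" "\<And>\<alpha>. v \<noteq> (\<lambda>j. \<alpha> * c j)" for v
  proof -
    have "?q * ?w = (\<Sum>\<alpha>\<in>(UNIV::'a set). ?w)" by simp
    also have "\<dots> \<le> (\<Sum>\<alpha>\<in>UNIV. card (supp (\<lambda>j. v j - \<alpha> * c j)))"
    proof (rule sum_mono)
      fix \<alpha> :: 'a
      have "(\<lambda>j. v j - \<alpha> * c j) \<noteq> 0" using v(2)[of \<alpha>] by (auto simp: fun_eq_iff)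
      then show "?w \<le> card (supp (\<lambda>j. v j - \<alpha> * c j))" using cmin diff v(1) c(1) by blast
    qed
    also have "\<dots> = ?q * card (supp v - supp c) + (?q - 1) * ?w"
      by (rule sum_card_supp_pencil[OF Suc.prems(1)]) (use sJ v c in auto)
    \<comment> \<open>Cancelling \<open>(q - 1) * w\<close> leaves a single \<open>w\<close> on the
      left.\<close>
    finally show ?thesis using q2 by (cases ?q) auto
  qed
  \<comment> \<open>Projection onto the residual code: coordinates in \<open>supp c\<close> are
    zeroed rather than deleted, which keeps the index type.\<close>
  define \<rho> :: "('i \<Rightarrow> 'a) \<Rightarrow> 'i \<Rightarrow> 'a" where "\<rho> v = (\<lambda>j. if c j = 0 then v j else 0)" for v
  have supp\<rho>: "supp (\<rho> v) = supp v - supp c" for v by (auto simp: \<rho>_def supp_def)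
  have \<rho>add: "\<rho> (x + y) = \<rho> x + \<rho> y" for x y by (auto simp: \<rho>_def fun_eq_iff)
  \<comment> \<open>By \<open>res\<close>, a word off the line of \<open>c\<close> is nonzero
    somewhere outside \<open>supp c\<close>. Hence the kernel is exactly that line, and the residual
    code has one dimension less.\<close>
  have ker: "{v \<in> V. \<rho> v = 0} = range (\<lambda>\<alpha> j. \<alpha> * c j)"
  proof (intro equalityI subsetI)
    fix v assume v: "v \<in> {v \<in> V. \<rho> v = 0}"
    then have "supp (\<rho> v) = {}" by (auto simp: supp_def)
    then have "card (supp v - supp c) = 0" by (simp only: supp\<rho> card.empty)
    then have "\<not> ?w \<le> ?q * card (supp v - supp c)" using w0 by simp
    then show "v \<in> range (\<lambda>\<alpha> j. \<alpha> * c j)" using res[of v] v by blast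
  next
    fix v assume "v \<in> range (\<lambda>\<alpha> j. \<alpha> * c j)"
    then show "v \<in> {v \<in> V. \<rho> v = 0}" using scl c(1) by (auto simp: \<rho>_def fun_eq_iff)
  qed
  have "inj (\<lambda>\<alpha> j. \<alpha> * c j)"
  proof (rule injI)
    fix \<alpha> \<beta> :: 'a assume e: "(\<lambda>j. \<alpha> * c j) = (\<lambda>j. \<beta> * c j)"
    from c(2) obtain j where "c j \<noteq> 0" by (auto simp: fun_eq_iff)
    then show "\<alpha> = \<beta>" using fun_cong[OF e, of j] by simp
  qed
  then have "card {v \<in> V. \<rho> v = 0} = ?q" unfolding ker by (rule card_image)
  moreover have "card V = card (\<rho> ` V) * card {v \<in> V. \<rho> v = 0}"
    by (rule card_image_kernel) (fact finV, rule add, assumption+, rule diff1, assumption+, rule \<rho>add)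
  ultimately have "card (\<rho> ` V) * ?q = ?q ^ k * ?q"
    using Suc.prems(5) by (metis mult.commute power_Suc)
  then have card\<rho>: "card (\<rho> ` V) = ?q ^ k" using q2 by simp
  have d: "d \<le> real ?w" using Suc.prems(6) c by blast
  \<comment> \<open>Residual weights are at least \<open>w / q\<close>, hence at least
    \<open>d / q\<close>. The Griesmer sum of the residual code is the tail of the original one, and
    the term \<open>i = 0\<close> is paid for by the coordinates in \<open>supp c\<close>.\<close>
  have IH: "(\<Sum>i<k. nat \<lceil>d / real ?q / real ?q ^ i\<rceil>) \<le> card (J - supp c)"
  proof (rule Suc.IH)
    show "finite (J - supp c)" using Suc.prems(1) by simp
    show "supp v \<subseteq> J - supp c" if "v \<in> \<rho> ` V" for v
      using that by (auto simp: supp\<rho>) (use sJ in blast)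
    show "x + y \<in> \<rho> ` V" if xy: "x \<in> \<rho> ` V" "y \<in> \<rho> ` V" for x y
    proof -
      from xy obtain v v' where v: "v \<in> V" "v' \<in> V" and "x = \<rho> v" "y = \<rho> v'" by blast
      then have "x + y = \<rho> (v + v')" by (simp only: \<rho>add)
      then show ?thesis using add[OF v] by blast
    qed
    show "(\<lambda>j. \<alpha> * x j) \<in> \<rho> ` V" if x: "x \<in> \<rho> ` V" for \<alpha> x
    proof -
      from x obtain v where "v \<in> V" "x = \<rho> v" by auto
      moreover have "(\<lambda>j. \<alpha> * \<rho> v j) = \<rho> (\<lambda>j. \<alpha> * v j)" by (auto simp: \<rho>_def)
      ultimately show ?thesis using scl by auto
    qed
    show "card (\<rho> ` V) = ?q ^ k" by (rule card\<rho>)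
    show "d / real ?q \<le> real (card (supp x))" if x: "x \<in> \<rho> ` V" "x \<noteq> 0" for x
    proof -
      from x obtain v where v: "v \<in> V" "x = \<rho> v" by auto
      then have "v \<notin> {v \<in> V. \<rho> v = 0}" using x by auto
      then have "\<And>\<alpha>. v \<noteq> (\<lambda>j. \<alpha> * c j)" using ker v by auto
      then have "?w \<le> ?q * card (supp x)" using res[of v] v by (simp add: supp\<rho>)
      then have "real ?w \<le> real ?q * real (card (supp x))" by (metis of_nat_le_iff of_nat_mult)
      then show ?thesis using d q2 by (simp add: field_simps)
    qed
  qed
  have "card (J - supp c) + ?w = card J"
    using sJ[OF c(1)] Suc.prems(1) by (simp add: card_Diff_subset fs[OF c(1)] card_mono)
  moreover have "nat \<lceil>d\<rceil> \<le> ?w" using d by (simp add: ceiling_le_iff nat_le_iff)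
  moreover have "(\<Sum>i<Suc k. nat \<lceil>d / real ?q ^ i\<rceil>)
      = nat \<lceil>d\<rceil> + (\<Sum>i<k. nat \<lceil>d / real ?q / real ?q ^ i\<rceil>)"
    by (subst sum.lessThan_Suc_shift) (simp add: field_simps)
  ultimately show ?case using IH by linarith
qed

text \<open>If \<open>c\<close> is not a multiple of a nonzero \<open>c'\<close> with smaller
  support, the words \<open>c - \<alpha> c'\<close> are all nonzero. Summing their weights gives
  \<open>q * lo \<le> (q - 1) * hi\<close>, against \<open>ratio\<close>.\<close>

theorem ashikhmin_barg:
  fixes C :: "(nat \<Rightarrow> 'a::{field,finite}) set"
  assumes lin: "lincode n C"
    and lo: "\<And>v. v \<in> C \<Longrightarrow> v \<noteq> 0 \<Longrightarrow> lo \<le> hwt v"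
    and hi: "\<And>v. v \<in> C \<Longrightarrow> hwt v \<le> hi"
    and ratio: "(CARD('a) - 1) * hi < CARD('a) * lo"
  shows "minimal_code C"
  unfolding minimal_code_def
proof (intro ballI impI)
  fix c c' assume c: "c \<in> C" "c' \<in> C" and "{j. c' j \<noteq> 0} \<subseteq> {j. c j \<noteq> 0}"
  then have sub: "supp c' \<subseteq> supp c" by (simp add: supp_def)
  let ?q = "CARD('a)"
  have q2: "?q \<ge> 2" by (rule card_field_ge2)
  note sJ = supp_lincode[OF lin]
  have diff: "(\<lambda>j. c j - \<alpha> * c' j) \<in> C" for \<alpha>
  proof -
    have "c + fscale (- \<alpha>) c' \<in> C" using c lin by (simp add: lincode_def)
    moreover have "c + fscale (- \<alpha>) c' = (\<lambda>j. c j - \<alpha> * c' j)"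
      by (auto simp: fun_eq_iff fscale_def)
    ultimately show ?thesis by simp
  qed
  show "\<exists>\<alpha>. c' = fscale \<alpha> c"
  proof (cases "\<exists>\<alpha>. c = (\<lambda>j. \<alpha> * c' j)")
    case True
    then obtain \<alpha> where a: "c = (\<lambda>j. \<alpha> * c' j)" by blast
    show ?thesis
    \<comment> \<open>If \<alpha> is zero then \<open>c = 0\<close>, and the inclusion of supports
      forces \<open>c' = 0\<close>; otherwise \<alpha> is inverted.\<close>
    proof (cases "\<alpha> = 0")
      case True
      then have "c' = fscale 0 c" using a sub by (auto simp: supp_def fscale_def)
      then show ?thesis by blast
    next
      case False
      then have "c' = fscale (1 / \<alpha>) c" using a by (auto simp: fscale_def)
      then show ?thesis by blast
    qed
  next
    case False
    \<comment> \<open>The term for \<alpha> = 0 is kept as the exact weight of \<open>c\<close>;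
      only the other \<open>q - 1\<close> terms are estimated by \<open>lo\<close>.\<close>
    have "(?q - 1) * lo + hwt c = (\<Sum>\<alpha>\<in>UNIV - {0::'a}. lo) + hwt c"
      by (simp add: card_Diff_singleton)
    also have "\<dots> \<le> (\<Sum>\<alpha>\<in>UNIV - {0}. card (supp (\<lambda>j. c j - \<alpha> * c' j))) + hwt c"
    proof (intro add_right_mono sum_mono)
      fix \<alpha> :: 'a
      have "(\<lambda>j. c j - \<alpha> * c' j) \<noteq> 0" using False by (auto simp: fun_eq_iff)
      then show "lo \<le> card (supp (\<lambda>j. c j - \<alpha> * c' j))"
        using lo[OF diff] by (simp add: hwt_eq_card_supp)
    qed
    also have "\<dots> = (\<Sum>\<alpha>\<in>UNIV. card (supp (\<lambda>j. c j - \<alpha> * c' j)))"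
      by (simp add: sum.remove[of UNIV "0::'a"] hwt_eq_card_supp)
    also have "\<dots> = ?q * card (supp c - supp c') + (?q - 1) * card (supp c')"
      by (rule sum_card_supp_pencil[of "{..<n}"]) (use sJ c in auto)
    finally have 1: "(?q - 1) * lo + hwt c \<le> ?q * card (supp c - supp c') + (?q - 1) * card (supp c')" .
    have "card (supp c - supp c') + card (supp c') = hwt c"
      using sub sJ[OF c(1)] by (metis card_Diff_subset card_mono finite_lessThan finite_subset hwt_eq_card_supp le_add_diff_inverse2)
    moreover have "c' \<noteq> 0 \<Longrightarrow> lo \<le> hwt c'" "hwt c \<le> hi" using lo hi c by auto
    moreover obtain p where p: "?q = Suc p" using q2 by (cases ?q) auto
    ultimately have "c' \<noteq> 0 \<Longrightarrow> ?q * lo \<le> (?q - 1) * hi"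
    proof -
      assume c0: "c' \<noteq> 0"
      have lo': "lo \<le> card (supp c')" using lo c c0 by (simp add: hwt_eq_card_supp)
      have "p * lo + lo \<le> p * hwt c"
        using 1 lo' \<open>card (supp c - supp c') + card (supp c') = hwt c\<close>[symmetric]
        by (simp add: p algebra_simps)
      also have "\<dots> \<le> p * hi" using hi[OF c(1)] by simp
      finally show ?thesis by (simp add: p algebra_simps)
    qed
    then have "c' = 0" using ratio by linarith
    then have "c' = fscale 0 c" by (simp add: fscale_def fun_eq_iff)
    then show ?thesis by blast
  qed
qed

section \<open>Linear forms and Gray images\<close>

lemma card_Delta:
  "card (Delta P :: ('n::finite \<Rightarrow> 'a::{zero,finite}) set) = CARD('a) ^ card P"
proof -
  have "bij_betw (\<lambda>v. restrict v P) (Delta P :: ('n \<Rightarrow> 'a) set) (P \<rightarrow>\<^sub>E UNIV)"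
    by (rule bij_betw_byWitness[where f' = "\<lambda>v i. if i \<in> P then v i else 0"])
      (auto simp: Delta_def supp_def fun_eq_iff PiE_def extensional_def split: if_splits)
  then show ?thesis by (simp add: bij_betw_same_card card_PiE)
qed

lemma Delta_add: "x + y \<in> Delta P" if "x \<in> Delta P" "y \<in> Delta P" for x y :: "'n \<Rightarrow> 'a::group_add"
  using that by (auto simp: Delta_def supp_def subset_iff) (metis add_0)

lemma Delta_diff: "x - y \<in> Delta P" if "x \<in> Delta P" "y \<in> Delta P" for x y :: "'n \<Rightarrow> 'a::group_add"
  using that by (auto simp: Delta_def supp_def subset_iff) (metis diff_zero)

lemma Delta_scale: "(\<lambda>i. \<alpha> * x i) \<in> Delta P" if "x \<in> Delta P" for x :: "'n \<Rightarrow> 'a::mult_zero"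
  using that by (auto simp: Delta_def supp_def)

lemma dotp_add_right: "dotp x (y + z) = dotp x y + dotp x z"
  by (simp add: dotp_def algebra_simps sum.distrib)

lemma dotp_add_left: "dotp (x + y) z = dotp x z + dotp y z"
  by (simp add: dotp_def algebra_simps sum.distrib)

lemma dotp_scale_right: "dotp x (\<lambda>i. \<alpha> * y i) = \<alpha> * dotp x y"
  by (simp add: dotp_def sum_distrib_left mult.left_commute)

lemma dotp_scale_left: "dotp (\<lambda>i. \<alpha> * x i) y = \<alpha> * dotp x y"
  by (simp add: dotp_def sum_distrib_left mult.assoc)

text \<open>This is the \<open>u\<close>-coefficient of the inner product with
  \<open>(x + u y, z)\<close>, hence the order in which \<open>y\<close> and \<open>x\<close>
  appear. The sum of the two coefficients is the same form with \<open>x + y\<close> in place of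
  \<open>y\<close>.\<close>

definition lform :: "('n::finite \<Rightarrow> 'a::field) \<Rightarrow> ('n \<Rightarrow> 'a) \<Rightarrow> ('n \<Rightarrow> 'a)
    \<Rightarrow> ('n, 'a) Rvec \<Rightarrow> 'a" where
  "lform y x z = (\<lambda>(w1, w2, w3). dotp y w1 + dotp x w2 + dotp z w3)"

lemma lform_add: "lform y x z (s + t) = lform y x z s + lform y x z t"
proof -
  obtain s1 s2 s3 t1 t2 t3 where "s = (s1, s2, s3)" "t = (t1, t2, t3)" by (metis prod_cases3)
  then show ?thesis by (simp only: lform_def add_Pair prod.case dotp_add_right add_ac)
qed

lemma lform_scale:
  "lform y x z ((\<lambda>i. \<alpha> * w1 i), (\<lambda>i. \<alpha> * w2 i), (\<lambda>i. \<alpha> * w3 i)) = \<alpha> * lform y x z (w1, w2, w3)"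
  by (simp add: lform_def dotp_scale_right distrib_left)

lemma dotp_unit: "dotp x (\<lambda>j. if j = i then 1 else 0) = x i"
  by (simp add: dotp_def if_distrib cong: if_cong)

lemma dotp_eq_0: "dotp x w = 0" if "\<forall>i\<in>P. x i = 0" "w \<in> Delta P"
  using that unfolding dotp_def Delta_def supp_def
  by (intro sum.neutral) auto

text \<open>A nonzero form is onto the field with fibres of equal size, so it is nonzero on a
  fraction \<open>(q - 1) / q\<close> of the space. With \<open>P\<close> nonempty the
  \<open>- 1\<close> in the exponent is a true subtraction.\<close>

lemma card_lform_nonzero:
  fixes x y z :: "'n::finite \<Rightarrow> 'a::{field,finite}"
  assumes "P \<noteq> {}"
  shows "card {s \<in> Delta P \<times> Delta Q \<times> Delta T. lform y x z s \<noteq> 0} =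
    (if (\<forall>i\<in>P. y i = 0) \<and> (\<forall>i\<in>Q. x i = 0) \<and> (\<forall>i\<in>T. z i = 0) then 0
     else (CARD('a) - 1) * CARD('a) ^ (card P + card Q + card T - 1))"
proof -
  let ?D = "Delta P \<times> Delta Q \<times> Delta T :: ('n, 'a) Rvec set"
  let ?f = "lform y x z"
  show ?thesis
  proof (cases "(\<forall>i\<in>P. y i = 0) \<and> (\<forall>i\<in>Q. x i = 0) \<and> (\<forall>i\<in>T. z i = 0)")
    case True
    then have "?f s = 0" if "s \<in> ?D" for s
      using that by (auto simp: lform_def dotp_eq_0)
    then have e: "{s \<in> ?D. ?f s \<noteq> 0} = {}" by blast
    show ?thesis unfolding e using True by simp
  next
    case False
    have ker: "card ?D = card (?f ` ?D) * card {s \<in> ?D. ?f s = 0}"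
    proof (rule card_image_kernel)
      show "finite ?D" by simp
      show "s + t \<in> ?D" if "s \<in> ?D" "t \<in> ?D" for s t
        using that by (auto simp: Delta_add)
      show "s - t \<in> ?D" if "s \<in> ?D" "t \<in> ?D" for s t
        using that by (auto simp: Delta_diff)
      show "?f (s + t) = ?f s + ?f t" for s t by (rule lform_add)
    qed
    have "\<exists>s\<in>?D. ?f s \<noteq> 0"
    proof -
      \<comment> \<open>Unit vectors detect a nonzero coefficient in whichever of the three
        components it occurs.\<close>
      let ?e = "\<lambda>i j. if j = i then 1 else (0::'a)"
      have e: "?e i \<in> Delta S" if "i \<in> S" for i :: 'n and S
        using that by (auto simp: Delta_def supp_def)
      have o: "(\<lambda>_. 0) \<in> Delta S" for S :: "'n set" by (auto simp: Delta_def supp_def)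
      have do0: "dotp v (\<lambda>_. 0) = 0" for v :: "'n \<Rightarrow> 'a" by (simp add: dotp_def)
      from False consider i where "i \<in> P" "y i \<noteq> 0" | i where "i \<in> Q" "x i \<noteq> 0"
        | i where "i \<in> T" "z i \<noteq> 0" by blast
      then show ?thesis
      proof cases
        case 1
        then show ?thesis
          by (intro bexI[of _ "(?e i, \<lambda>_. 0, \<lambda>_. 0)"]) (simp_all add: lform_def e o do0 dotp_unit)
      next
        case 2
        then show ?thesis
          by (intro bexI[of _ "(\<lambda>_. 0, ?e i, \<lambda>_. 0)"]) (simp_all add: lform_def e o do0 dotp_unit)
      next
        case 3
        then show ?thesis
          by (intro bexI[of _ "(\<lambda>_. 0, \<lambda>_. 0, ?e i)"]) (simp_all add: lform_def e o do0 dotp_unit)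
      qed
    qed
    then obtain w1 w2 w3 where w: "(w1, w2, w3) \<in> ?D" "?f (w1, w2, w3) \<noteq> 0" by (metis prod_cases3)
    have "t \<in> ?f ` ?D" for t
    proof -
      \<comment> \<open>Rescaling one vector of nonzero value reaches every
        \<open>t\<close>.\<close>
      let ?\<alpha> = "t / ?f (w1, w2, w3)"
      let ?s = "((\<lambda>i. ?\<alpha> * w1 i), (\<lambda>i. ?\<alpha> * w2 i), (\<lambda>i. ?\<alpha> * w3 i))"
      have s: "?s \<in> ?D" using w(1) by (simp only: mem_Times_iff fst_conv snd_conv Delta_scale simp_thms)
      have "t = ?f ?s" using w(2) by (simp only: lform_scale) simp
      then show ?thesis using s by (rule image_eqI)
    qed
    then have "?f ` ?D = UNIV" by blast
    then have kq: "card ?D = CARD('a) * card {s \<in> ?D. ?f s = 0}" using ker by simp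
    have cD: "card ?D = CARD('a) ^ (card P + card Q + card T)"
      by (simp add: card_cartesian_product card_Delta power_add algebra_simps)
    have "card P > 0" using assms by (simp add: card_gt_0_iff)
    then have "card ?D = CARD('a) * CARD('a) ^ (card P + card Q + card T - 1)"
      unfolding cD by (subst power_Suc[symmetric]) simp
    then have k: "card {s \<in> ?D. ?f s = 0} = CARD('a) ^ (card P + card Q + card T - 1)"
      using kq card_field_ge2[where 'a='a] by simp
    have "{s \<in> ?D. ?f s \<noteq> 0} = ?D - {s \<in> ?D. ?f s = 0}" by blast
    then have "card {s \<in> ?D. ?f s \<noteq> 0} = card ?D - card {s \<in> ?D. ?f s = 0}"
      by (simp add: card_Diff_subset)
    also have "\<dots> = (CARD('a) - 1) * CARD('a) ^ (card P + card Q + card T - 1)"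
      using kq k by (simp add: diff_mult_distrib)
    finally show ?thesis by (simp only: False if_False)
  qed
qed

text \<open>The whole space is the disjoint union of the defining set and the removed subspace, and
  both are products of spaces \<open>Delta\<close>. The count is stated as a sum to avoid truncated
  subtraction, with a common factor that later becomes \<open>M\<close>.\<close>

lemma card_lform_nonzero_diff:
  fixes x y z :: "'n::finite \<Rightarrow> 'a::{field,finite}"
  assumes "A \<noteq> {}" "C \<noteq> {}"
  shows "card {s \<in> Delta A \<times> DeltaC B \<times> Delta C. lform y x z s \<noteq> 0} +
     (if (\<forall>i\<in>A. y i = 0) \<and> (\<forall>i\<in>B. x i = 0) \<and> (\<forall>i\<in>C. z i = 0) then 0
     else (CARD('a) - 1) * CARD('a) ^ (card A + card C - 1) * CARD('a) ^ card B) =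
    (if (\<forall>i\<in>A. y i = 0) \<and> (\<forall>i. x i = 0) \<and> (\<forall>i\<in>C. z i = 0) then 0
     else (CARD('a) - 1) * CARD('a) ^ (card A + card C - 1) * CARD('a) ^ CARD('n))"
proof -
  have pw: "CARD('a) ^ (card A + k + card C - 1) = CARD('a) ^ (card A + card C - 1) * CARD('a) ^ k" for k
  proof -
    have "card A > 0" using assms by (simp add: card_gt_0_iff)
    then have "card A + k + card C - 1 = (card A + card C - 1) + k" by simp
    then show ?thesis by (simp add: power_add)
  qed
  let ?U = "{s \<in> Delta A \<times> Delta UNIV \<times> Delta C. lform y x z s \<noteq> 0}"
  let ?S = "{s \<in> Delta A \<times> DeltaC B \<times> Delta C. lform y x z s \<noteq> 0}"
  let ?B = "{s \<in> Delta A \<times> Delta B \<times> Delta C. lform y x z s \<noteq> 0}"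
  have "?U = ?S \<union> ?B" "?S \<inter> ?B = {}"
    by (auto simp: DeltaC_def Delta_def)
  then have "card ?S + card ?B = card ?U" by (simp add: card_Un_disjoint)
  then show ?thesis
    using card_lform_nonzero[OF assms(1), of B C y x z] card_lform_nonzero[OF assms(1), of UNIV C y x z]
    by (simp only: pw UNIV_I Ball_def simp_thms mult.assoc split: if_splits)
qed

section \<open>Gray images as pairs of linear forms\<close>

definition gray_word :: "('n::finite, 'a::field) Rvec list
    \<Rightarrow> ('n, 'a) Rvec \<Rightarrow> nat \<Rightarrow> 'a" where
  "gray_word ds = (\<lambda>(x, y, z) j. if j < length ds then lform y x z (ds ! j)
     else if j < 2 * length ds then lform (x + y) x z (ds ! (j - length ds)) else 0)"

text \<open>From here on the ring is gone: the Gray image is the range of an additive map defined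
  over the field.\<close>

lemma gray_codeD: "gray (length ds) ` codeD ds = range (gray_word ds)"
proof -
  have "gray (length ds) (\<lambda>j. if j < length ds then Rinner r (ds ! j) else (0, 0)) = gray_word ds r" for r
  proof -
    have R: "snd (Rinner (x, y, z) s) = lform y x z s"
      "fst (Rinner (x, y, z) s) = lform (x + y) x z s - lform y x z s" for x y z s
      by (cases s; simp add: Rinner_def radd_def rdot_def rmul_def ru_def rsum_def lform_def
          dotp_def sum.distrib algebra_simps)+
    show ?thesis
      by (cases r) (auto simp: gray_def gray_word_def fun_eq_iff R)
  qed
  moreover have "codeD ds = range (\<lambda>r j. if j < length ds then Rinner r (ds ! j) else (0, 0))"
    by (auto simp: codeD_def)
  ultimately show ?thesis by (simp only: image_image)
qed

lemma lform_add_left: "lform (y + y') (x + x') (z + z') s = lform y x z s + lform y' x' z' s"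
  by (cases s) (simp only: lform_def prod.case dotp_add_left add_ac)

lemma lform_scale_left:
  "lform (\<lambda>i. \<alpha> * y i) (\<lambda>i. \<alpha> * x i) (\<lambda>i. \<alpha> * z i) s = \<alpha> * lform y x z s"
  by (cases s) (simp only: lform_def prod.case dotp_scale_left distrib_left)

lemma gray_word_add: "gray_word ds (r + s) = gray_word ds r + gray_word ds s"
proof -
  obtain x y z x' y' z' where r: "r = (x, y, z)" "s = (x', y', z')" by (metis prod_cases3)
  have "(x + x') + (y + y') = (x + y) + (x' + y')" by (simp only: add_ac)
  then show ?thesis unfolding r gray_word_def add_Pair prod.case
    by (simp only: lform_add_left) (auto simp: fun_eq_iff)
qed

lemma gray_word_scale:
  "gray_word ds ((\<lambda>i. \<alpha> * x i), (\<lambda>i. \<alpha> * y i), (\<lambda>i. \<alpha> * z i)) = fscale \<alpha> (gray_word ds (x, y, z))"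
proof -
  have "(\<lambda>i. \<alpha> * x i) + (\<lambda>i. \<alpha> * y i) = (\<lambda>i. \<alpha> * (x + y) i)" by (auto simp: algebra_simps)
  then show ?thesis unfolding gray_word_def prod.case
    by (simp only: lform_scale_left) (auto simp: fun_eq_iff fscale_def)
qed

lemma lincode_gray_word: "lincode (2 * length ds) (range (gray_word ds))"
  unfolding lincode_def
proof (intro conjI ballI allI)
  show "range (gray_word ds) \<subseteq> {v. \<forall>j\<ge>2 * length ds. v j = 0}"
    by (auto simp: gray_word_def)
  have "gray_word ds (0, 0, 0) = 0"
    by (auto simp: gray_word_def lform_def dotp_def fun_eq_iff split: prod.splits)
  then show "0 \<in> range (gray_word ds)" by (metis rangeI)
next
  fix v w assume "v \<in> range (gray_word ds)" "w \<in> range (gray_word ds)"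
  then show "v + w \<in> range (gray_word ds)" by (auto simp: gray_word_add[symmetric])
next
  fix \<alpha> v assume "v \<in> range (gray_word ds)"
  then show "fscale \<alpha> v \<in> range (gray_word ds)" by (auto simp: gray_word_scale[symmetric])
qed

text \<open>Distinctness lets positions of a codeword be counted as elements of the defining set, so
  the listing order is irrelevant for weights.\<close>

lemma card_nth_filter:
  assumes "distinct ds"
  shows "card {j. j < length ds \<and> P (ds ! j)} = card {s \<in> set ds. P s}"
proof -
  have "card {s \<in> set ds. P s} = length (filter P ds)"
    using distinct_card[of "filter P ds"] assms by simp
  then show ?thesis by (simp add: length_filter_conv_card)
qed

lemma hwt_gray_word:
  assumes "distinct ds"
  shows "hwt (gray_word ds (x, y, z)) = card {s \<in> set ds. lform y x z s \<noteq> 0}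
    + card {s \<in> set ds. lform (x + y) x z s \<noteq> 0}"
proof -
  let ?N = "length ds"
  let ?I = "{j. j < ?N \<and> lform y x z (ds ! j) \<noteq> 0}"
  let ?K = "{j. j < ?N \<and> lform (x + y) x z (ds ! j) \<noteq> 0}"
  have "{j. gray_word ds (x, y, z) j \<noteq> 0} = ?I \<union> (\<lambda>j. j + ?N) ` ?K"
  proof (intro equalityI subsetI)
    fix j assume j: "j \<in> {j. gray_word ds (x, y, z) j \<noteq> 0}"
    show "j \<in> ?I \<union> (\<lambda>j. j + ?N) ` ?K"
    proof (cases "j < ?N")
      case True
      then show ?thesis using j by (auto simp: gray_word_def)
    next
      case False
      then have "j = (j - ?N) + ?N" "j - ?N \<in> ?K" using j by (auto simp: gray_word_def split: if_splits)
      then show ?thesis by blast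
    qed
  qed (auto simp: gray_word_def)
  moreover have "?I \<inter> (\<lambda>j. j + ?N) ` ?K = {}" by auto
  ultimately have "hwt (gray_word ds (x, y, z)) = card ?I + card ?K"
    unfolding hwt_def by (simp add: card_Un_disjoint card_image)
  then show ?thesis 
    by (simp only: card_nth_filter[OF assms, of "\<lambda>s. lform _ _ _ s \<noteq> 0"])
qed

section \<open>The Griesmer sum and self-orthogonality\<close>

text \<open>The \<open>i\<close>-th term before rounding is \<open>h k i\<close> minus a correction.
  The correction is the integer \<open>h t i\<close> for \<open>i < t\<close>, lies in
  \<open>[1, 2)\<close> at \<open>i = t\<close>, and in \<open>[0, 1)\<close> beyond. The ceiling
  therefore subtracts its floor \<open>e i\<close>, and the one unit at \<open>i = t\<close> causes
  the final \<open>- 1\<close>.\<close>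

lemma griesmer_sum:
  fixes q k t :: nat
  assumes q: "2 \<le> q" and t: "1 \<le> t" "t < k"
  shows "(\<Sum>i<k. nat \<lceil>real (2 * (q - 1) * (q ^ (k - 1) - q ^ (t - 1))) / real q ^ i\<rceil>)
    = 2 * (q ^ k - q ^ t) - 1"
proof -
  define Q where "Q = real q"
  define d where "d = 2 * (q - 1) * (q ^ (k - 1) - q ^ (t - 1))"
  \<comment> \<open>The geometric term \<open>2 (q - 1) q^(n - 1 - i)\<close>, whose sum over
    \<open>i < n\<close> telescopes to \<open>2 (q^n - 1)\<close>; it is used with
    \<open>n = k\<close> and \<open>n = t\<close>.\<close>
  define h where "h n i = 2 * (int q - 1) * int q ^ (n - Suc i)" for n i
  define e where "e i = (if i < t then h t i else if i = t then 1 else 0)" for i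
  have Q2: "Q \<ge> 2" using q by (simp add: Q_def)
  have "q ^ (t - 1) \<le> q ^ (k - 1)" using q t by (intro power_increasing) auto
  then have d: "real d = 2 * (Q - 1) * (Q ^ (k - 1) - Q ^ (t - 1))"
    using q by (simp add: d_def Q_def of_nat_diff)
  have hQ: "real_of_int (h n i) = 2 * (Q - 1) * Q ^ (n - 1) / Q ^ i" if "i < n" for n i
  proof -
    have "Q ^ (n - 1) = Q ^ (n - Suc i) * Q ^ i"
      using that by (simp add: power_add[symmetric])
    then show ?thesis using Q2 by (simp add: h_def Q_def)
  qed
  have ceil: "\<lceil>real d / Q ^ i\<rceil> = h k i - e i" if i: "i < k" for i
  proof -
    have dd: "real d / Q ^ i = h k i - 2 * (Q - 1) * Q ^ (t - 1) / Q ^ i"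
      unfolding hQ[OF i] d by (simp add: diff_divide_distrib right_diff_distrib)
    consider "i < t" | "i = t" | "i > t" by linarith
    then show ?thesis
    proof cases
      case 1
      then have "real d / Q ^ i = of_int (h k i - h t i)" using dd hQ[OF 1] by simp
      then show ?thesis using 1 by (simp only: ceiling_of_int e_def if_True)
    next
      case 2
      have "Q ^ t = Q ^ (t - 1) * Q" using t by (simp add: power_eq_if mult.commute)
      then have "2 * (Q - 1) * Q ^ (t - 1) / Q ^ i = 2 * (Q - 1) / Q" using Q2 2 by simp
      moreover have "1 \<le> 2 * (Q - 1) / Q" "2 * (Q - 1) / Q < 2" using Q2 by (simp_all add: field_simps)
      ultimately show ?thesis unfolding dd using 2 by (intro ceiling_unique) (simp_all add: e_def)
    next
      case 3
      have "Q ^ i \<ge> Q ^ (t - 1 + 2)" using Q2 3 t by (intro power_increasing) auto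
      then have "Q ^ i \<ge> Q ^ (t - 1) * Q\<^sup>2" by (simp only: power_add)
      \<comment> \<open>Expanding \<open>(Q - 1)^2 \<ge> 0\<close> gives
        \<open>2 Q - 1 \<le> Q^2\<close>.\<close>
      moreover have "2 * (Q - 1) < Q\<^sup>2"
        using zero_le_power2[of "Q - 1"] by (simp add: power2_eq_square algebra_simps)
      then have "2 * (Q - 1) * Q ^ (t - 1) < Q ^ (t - 1) * Q\<^sup>2"
        using Q2 by (simp add: mult.commute)
      ultimately have "2 * (Q - 1) * Q ^ (t - 1) / Q ^ i < 1" using Q2 by (simp add: field_simps)
      moreover have "0 \<le> 2 * (Q - 1) * Q ^ (t - 1) / Q ^ i" using Q2 by simp
      ultimately show ?thesis unfolding dd using 3 by (intro ceiling_unique) (simp_all add: e_def)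
    qed
  qed
  have hsum: "(\<Sum>i<n. h n i) = 2 * (int q ^ n - 1)" for n
  proof -
    have "(\<Sum>i<n. h n i) = 2 * ((int q - 1) * (\<Sum>i<n. int q ^ (n - Suc i)))"
      by (simp only: h_def sum_distrib_left mult.assoc)
    also have "\<dots> = 2 * (int q ^ n - 1)"
      unfolding sum.nat_diff_reindex by (simp add: power_diff_1_eq)
    finally show ?thesis .
  qed
  have "(\<Sum>i<k. e i) = (\<Sum>i<Suc t. e i)"
    by (rule sum.mono_neutral_right) (use t in \<open>auto simp: e_def\<close>)
  also have "\<dots> = (\<Sum>i<t. h t i) + 1" by (simp add: e_def)
  finally have esum: "(\<Sum>i<k. e i) = 2 * (int q ^ t - 1) + 1" by (simp only: hsum)
  have "int (\<Sum>i<k. nat \<lceil>real d / Q ^ i\<rceil>) = (\<Sum>i<k. \<lceil>real d / Q ^ i\<rceil>)"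
    using Q2 by (simp add: ceiling_mono[of 0, simplified])
  also have "\<dots> = (\<Sum>i<k. h k i - e i)" by (rule sum.cong) (auto simp: ceil)
  also have "\<dots> = 2 * (int q ^ k - int q ^ t) - 1"
    unfolding sum_subtractf hsum esum by simp
  finally have 1: "int (\<Sum>i<k. nat \<lceil>real d / Q ^ i\<rceil>) = 2 * (int q ^ k - int q ^ t) - 1" .
  have "q ^ t < q ^ k" using q t by (intro power_strict_increasing) auto
  then have "int (2 * (q ^ k - q ^ t) - 1) = 2 * (int q ^ k - int q ^ t) - 1"
    by (simp add: of_nat_diff)
  then show ?thesis using 1 unfolding d_def Q_def by linarith
qed

text \<open>For \<open>i < t\<close> the quotient \<open>d / q^i\<close> is an integer, so any
  increase of the numerator raises the ceiling by at least one; these \<open>t\<close> terms all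
  gain.\<close>

lemma griesmer_sum_Suc:
  fixes q k t d :: nat
  assumes q: "2 \<le> q" and t: "t \<le> k" and dvd: "q ^ (t - 1) dvd d"
  shows "(\<Sum>i<k. nat \<lceil>real d / real q ^ i\<rceil>) + t \<le> (\<Sum>i<k. nat \<lceil>(real d + 1) / real q ^ i\<rceil>)"
proof -
  have le: "real d / real q ^ i \<le> (real d + 1) / real q ^ i" for i
    by (intro divide_right_mono) auto
  have "nat \<lceil>real d / real q ^ i\<rceil> + of_bool (i < t) \<le> nat \<lceil>(real d + 1) / real q ^ i\<rceil>" for i
  proof (cases "i < t")
    case False
    then show ?thesis using nat_mono[OF ceiling_mono[OF le]] by simp
  next
    case True
    then have "q ^ i dvd q ^ (t - 1)" by (intro le_imp_power_dvd) auto
    then obtain e where "d = q ^ i * e" using dvd dvd_trans by blast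
    then have e: "real d / real q ^ i = real e" using q by simp
    have "real d / real q ^ i < (real d + 1) / real q ^ i"
      using q by (intro divide_strict_right_mono) auto
    then have "int e < \<lceil>(real d + 1) / real q ^ i\<rceil>" unfolding e less_ceiling_iff by simp
    then show ?thesis using True by (simp add: e)
  qed
  then have "(\<Sum>i<k. nat \<lceil>real d / real q ^ i\<rceil> + of_bool (i < t)) \<le> (\<Sum>i<k. nat \<lceil>(real d + 1) / real q ^ i\<rceil>)"
    by (rule sum_mono)
  moreover have "(\<Sum>i<k. of_bool (i < t)) = t"
  proof -
    have "{..<k} \<inter> {i. i < t} = {..<t}" using t by auto
    then show ?thesis by (simp add: sum_of_bool_eq)
  qed
  ultimately show ?thesis by (simp add: sum.distrib)
qed

section \<open>Minimum distance and weights of a linear code\<close>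

lemma hdist_eq_hwt_diff: "hdist x y = hwt (x - y)" for x y :: "nat \<Rightarrow> 'a::group_add"
  by (simp add: hdist_def hwt_def)

lemma lincode_uminus: "- x \<in> C" if "lincode n C" "x \<in> C"
proof -
  have "fscale (- 1) x \<in> C" using that by (simp add: lincode_def)
  moreover have "fscale (- 1) x = - x" by (auto simp: fscale_def fun_eq_iff)
  ultimately show ?thesis by simp
qed

lemma lincode_diff: "x - y \<in> C" if "lincode n C" "x \<in> C" "y \<in> C"
proof -
  have "x + - y \<in> C" using that lincode_uminus[OF that(1,3)] unfolding lincode_def by blast
  then show ?thesis by (simp only: add_uminus_conv_diff)
qed

lemma finite_lincode:
  fixes C :: "(nat \<Rightarrow> 'a::{field,finite}) set"
  assumes "lincode n C"
  shows "finite C"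
  by (rule finite_subset[OF _ finite_words[of "{..<n}"]]) (use supp_lincode[OF assms] in auto)

lemma mindist_lincode:
  assumes "lincode n C"
  shows "mindist C = Inf (nonzero_weights C)"
proof -
  have "{hdist x y | x y. x \<in> C \<and> y \<in> C \<and> x \<noteq> y} = nonzero_weights C"
  proof (intro equalityI subsetI)
    fix w assume "w \<in> {hdist x y | x y. x \<in> C \<and> y \<in> C \<and> x \<noteq> y}"
    then obtain x y where "w = hdist x y" "x \<in> C" "y \<in> C" "x \<noteq> y" by blast
    then show "w \<in> nonzero_weights C"
      unfolding nonzero_weights_def hdist_eq_hwt_diff using lincode_diff[OF assms] by fastforce
  next
    fix w assume "w \<in> nonzero_weights C"
    then obtain c where c: "w = hwt c" "c \<in> C" "c \<noteq> 0" unfolding nonzero_weights_def by blast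
    moreover have "0 \<in> C" using assms by (simp add: lincode_def)
    moreover have "hwt c = hdist c 0" by (simp add: hdist_eq_hwt_diff)
    ultimately show "w \<in> {hdist x y | x y. x \<in> C \<and> y \<in> C \<and> x \<noteq> y}" by blast
  qed
  then show ?thesis by (simp add: mindist_def)
qed

lemma nonzero_weights_wfreq:
  assumes "finite C"
  shows "nonzero_weights C = {w. wfreq C w \<noteq> 0}"
  using assms by (auto simp: nonzero_weights_def wfreq_def)

text \<open>Translation by 1 permutes the field, so the sum of all elements is unchanged when
  \<open>q\<close> ones are added to it.\<close>

lemma of_nat_card_field: "of_nat CARD('a) = (0::'a::{field,finite})"
proof -
  have "(\<Sum>x\<in>(UNIV::'a set). x + 1) = (\<Sum>x\<in>UNIV. x)"
    by (rule sum.reindex_bij_witness[of _ "\<lambda>x. x - 1" "\<lambda>x. x + 1"]) auto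
  then show ?thesis by (simp add: sum.distrib)
qed

text \<open>From \<open>wt (x + y) + 2 |supp x \<inter> supp y| = wt x + wt y\<close> and
  divisibility by 4, the supports meet in an even number of positions, and that number modulo 2 is
  the inner product.\<close>

lemma self_orthogonal_binary:
  fixes C :: "(nat \<Rightarrow> 'a::{field,finite}) set"
  assumes q: "CARD('a) = 2" and lin: "lincode n C" and wt: "\<And>v. v \<in> C \<Longrightarrow> 4 dvd hwt v"
  shows "self_orthogonal n C"
  unfolding self_orthogonal_def
proof (intro ballI)
  fix x y assume xy: "x \<in> C" "y \<in> C"
  have U: "(UNIV :: 'a set) = {0, 1}"
    by (rule card_subset_eq[symmetric]) (simp_all add: q)
  have c01: "a = 0 \<or> a = 1" for a :: 'a using U by blast
  have two: "(1::'a) + 1 = 0" using of_nat_card_field[where 'a='a] by (simp add: q)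
  note sx = supp_lincode[OF lin xy(1)] and sy = supp_lincode[OF lin xy(2)]
  have fin: "finite (supp x)" "finite (supp y)" using sx sy finite_subset by blast+
  have "x j * y j = of_bool (j \<in> supp x \<inter> supp y)" for j
    using c01[of "x j"] c01[of "y j"] by (auto simp: supp_def)
  then have "(\<Sum>j<n. x j * y j) = (\<Sum>j<n. of_bool (j \<in> supp x \<inter> supp y))" by simp
  also have "\<dots> = of_nat (card ({..<n} \<inter> (supp x \<inter> supp y)))"
    by (subst sum_of_bool_eq) (simp_all only: Collect_mem_eq finite_lessThan)
  also have "{..<n} \<inter> (supp x \<inter> supp y) = supp x \<inter> supp y" using sx by blast
  finally have s: "(\<Sum>j<n. x j * y j) = of_nat (card (supp x \<inter> supp y))" .
  have ne: "(a + b \<noteq> 0) \<longleftrightarrow> (a \<noteq> 0) \<noteq> (b \<noteq> 0)" for a b :: 'a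
    using c01[of a] c01[of b] two by auto
  have "supp (x + y) = (supp x - supp y) \<union> (supp y - supp x)"
    unfolding supp_def plus_fun_apply ne by auto
  then have "hwt (x + y) = card (supp x - supp y) + card (supp y - supp x)"
    unfolding hwt_eq_card_supp by (simp only:) (rule card_Un_disjoint, use fin in auto)
  moreover have "card (supp x - supp y) + card (supp x \<inter> supp y) = hwt x"
    "card (supp y - supp x) + card (supp x \<inter> supp y) = hwt y"
    unfolding hwt_eq_card_supp using fin card_Int_Diff[of "supp x" "supp y"] card_Int_Diff[of "supp y" "supp x"]
    by (simp_all add: Int_commute)
  ultimately have "hwt (x + y) + 2 * card (supp x \<inter> supp y) = hwt x + hwt y" by linarith
  moreover have "x + y \<in> C" using lin xy by (simp only: lincode_def)
  ultimately have "4 dvd 2 * card (supp x \<inter> supp y)"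
    using wt[of "x + y"] dvd_add[OF wt[OF xy(1)] wt[OF xy(2)]] by (metis dvd_add_right_iff)
  moreover have "even k" if "4 dvd 2 * k" for k :: nat using that by presburger
  ultimately have "even (card (supp x \<inter> supp y))" by blast
  then obtain k where "card (supp x \<inter> supp y) = 2 * k" by (rule evenE)
  then have "(\<Sum>j<n. x j * y j) = (1 + 1) * of_nat k"
    unfolding s by (simp only: mult_2 of_nat_add distrib_right mult_1)
  then show "(\<Sum>j<n. x j * y j) = 0" by (simp only: two mult_zero_left)
qed

text \<open>Nonzero squares are 1 in the field of order 3, so the inner product of a word with
  itself is its weight modulo 3 and vanishes. Polarization extends this to pairs.\<close>

lemma self_orthogonal_ternary:
  fixes C :: "(nat \<Rightarrow> 'a::{field,finite}) set"
  assumes q: "CARD('a) = 3" and lin: "lincode n C" and wt: "\<And>v. v \<in> C \<Longrightarrow> 3 dvd hwt v"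
  shows "self_orthogonal n C"
  unfolding self_orthogonal_def
proof (intro ballI)
  fix x y assume xy: "x \<in> C" "y \<in> C"
  have three: "(3::'a) = 0" using of_nat_card_field[where 'a='a] by (simp add: q)
  have sq: "a * a = of_bool (a \<noteq> 0)" for a :: 'a
  proof (cases "a = 0 \<or> a = 1")
    case False
    \<comment> \<open>Any third element \<open>a\<close> has its square among \<open>0\<close>,
      \<open>1\<close>, \<open>a\<close>; the first and the last would give \<open>a = 0\<close> or
      \<open>a = 1\<close>.\<close>
    then have "{0, 1, a} = (UNIV :: 'a set)" by (intro card_subset_eq) (auto simp: q)
    then have "a * a = 0 \<or> a * a = 1 \<or> a * a = a" by blast
    then show ?thesis using False by auto
  qed auto
  have norm0: "(\<Sum>j<n. v j * v j) = 0" if v: "v \<in> C" for v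
  proof -
    have "(\<Sum>j<n. v j * v j) = of_nat (card ({..<n} \<inter> {j. v j \<noteq> 0}))"
      unfolding sq by (subst sum_of_bool_eq) simp_all
    also have "{..<n} \<inter> {j. v j \<noteq> 0} = supp v"
      using supp_lincode[OF lin v] by (auto simp: supp_def)
    also have "of_nat (card (supp v)) = (0::'a)"
      using wt[OF v] three unfolding hwt_eq_card_supp by (elim dvdE) simp
    finally show ?thesis .
  qed
  have "x + y \<in> C" using lin xy by (simp only: lincode_def)
  then have "(\<Sum>j<n. (x + y) j * (x + y) j) = 0" by (rule norm0)
  moreover have "(\<Sum>j<n. (x + y) j * (x + y) j)
      = (\<Sum>j<n. x j * x j) + (\<Sum>j<n. y j * y j) + 2 * (\<Sum>j<n. x j * y j)"
    by (simp add: sum.distrib[symmetric] sum_distrib_left algebra_simps)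
  ultimately have "2 * (\<Sum>j<n. x j * y j) = 0" using norm0 xy by simp
  \<comment> \<open>Since \<open>2 s = 0\<close>, the inner product \<open>s\<close> equals
    \<open>3 s\<close>, which is 0.\<close>
  moreover have "(3::'a) = 2 + 1" by simp
  ultimately have "3 * (\<Sum>j<n. x j * y j) = (\<Sum>j<n. x j * y j)"
    by (simp only: distrib_right mult_1 add_0)
  then show "(\<Sum>j<n. x j * y j) = 0" using three by simp
qed

section \<open>The defining set with a removed subspace\<close>

text \<open>The numbers \<open>M\<close>, \<open>d\<close>, \<open>w2\<close>, \<open>w3\<close> are
  parameters fixed by equations, so that an interpretation can supply the literal expressions of the
  theorem. \<open>M\<close> is the factor common to all weights.\<close>

locale defining_set =
  fixes A B C :: "'n::finite set" and ds :: "('n, 'a::{field,finite}) Rvec list"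
    and M d w2 w3 :: nat
  assumes nA: "A \<noteq> {}" and nB: "B \<noteq> {}" and nC: "C \<noteq> {}"
    and Bsmall: "card B < CARD('n)"
    and AnotB: "\<not> A \<subseteq> B"
    and distinct: "distinct ds"
    and set_ds: "set ds = Delta A \<times> DeltaC B \<times> Delta C"
    and M_def: "M = (CARD('a) - 1) * CARD('a) ^ (card A + card C - 1)"
    and d_def: "d = 2 * M * (CARD('a) ^ CARD('n) - CARD('a) ^ card B)"
    and w2_def: "w2 = M * (2 * CARD('a) ^ CARD('n) - CARD('a) ^ card B)"
    and w3_def: "w3 = 2 * M * CARD('a) ^ CARD('n)"
begin

text \<open>Messages \<open>(x, y, z)\<close> modulo what the defining set cannot see: only the
  entries of \<open>y\<close> on \<open>A\<close> and of \<open>z\<close> on \<open>C\<close> affect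
  a codeword. On these representatives \<open>gray_word ds\<close> is injective.\<close>

definition params :: "('n, 'a) Rvec set" where
  "params = UNIV \<times> Delta A \<times> Delta C"

text \<open>The parameters whose first, respectively second, Gray half fails to vanish
  on the removed part \<open>Delta A \<times> Delta B \<times> Delta C\<close> are those outside \<open>E1\<close>,
  respectively outside \<open>E2\<close>.\<close>

definition E1 :: "('n, 'a) Rvec set" where
  "E1 = Delta (- B) \<times> {0} \<times> {0}"

definition E2 :: "('n, 'a) Rvec set" where
  "E2 = (\<lambda>x. (x, (\<lambda>i. if i \<in> A then - x i else 0), 0)) ` Delta (- B)"

lemma q2: "2 \<le> CARD('a)"
  by (rule card_field_ge2)

lemma M_pos: "0 < M"
  using q2 by (simp add: M_def)

lemma card_pos: "0 < card A" "0 < card B" "0 < card C"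
  using nA nB nC by (simp_all add: card_gt_0_iff)

text \<open>A nonzero form vanishing on the removed subspace keeps the full count
  \<open>M * q^m\<close>; any other nonzero form loses the \<open>M * q^b\<close> nonzero values
  that it takes there.\<close>

lemma card_half:
  fixes x y z :: "'n \<Rightarrow> 'a"
  shows "card {s \<in> set ds. lform y x z s \<noteq> 0} =
    (if (\<forall>i\<in>A. y i = 0) \<and> (\<forall>i\<in>C. z i = 0) \<and> (\<forall>i. x i = 0) then 0
     else if (\<forall>i\<in>A. y i = 0) \<and> (\<forall>i\<in>C. z i = 0) \<and> (\<forall>i\<in>B. x i = 0) then M * CARD('a) ^ CARD('n)
     else M * (CARD('a) ^ CARD('n) - CARD('a) ^ card B))"
proof -
  have *: "card {s \<in> set ds. lform y x z s \<noteq> 0} +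
     (if (\<forall>i\<in>A. y i = 0) \<and> (\<forall>i\<in>B. x i = 0) \<and> (\<forall>i\<in>C. z i = 0) then 0 else M * CARD('a) ^ card B) =
    (if (\<forall>i\<in>A. y i = 0) \<and> (\<forall>i. x i = 0) \<and> (\<forall>i\<in>C. z i = 0) then 0 else M * CARD('a) ^ CARD('n))"
    unfolding set_ds M_def by (rule card_lform_nonzero_diff[OF nA nC])
  show ?thesis
  proof (cases "(\<forall>i\<in>A. y i = 0) \<and> (\<forall>i\<in>C. z i = 0) \<and> (\<forall>i\<in>B. x i = 0)")
    case True
    then show ?thesis using * by (simp split: if_splits)
  next
    case False
    then have "card {s \<in> set ds. lform y x z s \<noteq> 0} + M * CARD('a) ^ card B = M * CARD('a) ^ CARD('n)"
      using * by (auto split: if_splits)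
    then have "card {s \<in> set ds. lform y x z s \<noteq> 0} = M * (CARD('a) ^ CARD('n) - CARD('a) ^ card B)"
      by (simp add: diff_mult_distrib2)
    then show ?thesis using False by auto
  qed
qed

text \<open>On \<open>params\<close>, vanishing of \<open>y\<close> on \<open>A\<close> means
  \<open>y = 0\<close>, and vanishing of \<open>x + y\<close> on \<open>A\<close> means that
  \<open>y\<close> is \<open>- x\<close> cut off to \<open>A\<close>. Together with
  \<open>x = 0\<close> and \<open>z = 0\<close>, either condition gives \<open>r = 0\<close>, so
  both halves vanish only for the zero parameter.\<close>

lemma hwt_params:
  assumes "r \<in> params"
  shows "hwt (gray_word ds r) = (if r = 0 then 0 else
     (if r \<in> E1 then M * CARD('a) ^ CARD('n) else M * (CARD('a) ^ CARD('n) - CARD('a) ^ card B)) +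
     (if r \<in> E2 then M * CARD('a) ^ CARD('n) else M * (CARD('a) ^ CARD('n) - CARD('a) ^ card B)))"
proof -
  obtain x y z where r: "r = (x, y, z)" by (metis prod_cases3)
  have y: "(\<forall>i\<in>A. y i = 0) \<longleftrightarrow> y = 0" and z: "(\<forall>i\<in>C. z i = 0) \<longleftrightarrow> z = 0"
    and xy: "(\<forall>i\<in>A. (x + y) i = 0) \<longleftrightarrow> y = (\<lambda>i. if i \<in> A then - x i else 0)"
    using assms by (auto simp: params_def r Delta_def supp_def fun_eq_iff add_eq_0_iff)
  have x: "(\<forall>i\<in>B. x i = 0) \<longleftrightarrow> x \<in> Delta (- B)" "(\<forall>i. x i = 0) \<longleftrightarrow> x = 0"
    by (auto simp: Delta_def supp_def fun_eq_iff)
  have E: "r \<in> E1 \<longleftrightarrow> x \<in> Delta (- B) \<and> y = 0 \<and> z = 0"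
    "r \<in> E2 \<longleftrightarrow> x \<in> Delta (- B) \<and> y = (\<lambda>i. if i \<in> A then - x i else 0) \<and> z = 0"
    by (auto simp: r E1_def E2_def)
  have r0: "r = 0 \<longleftrightarrow> y = 0 \<and> z = 0 \<and> x = 0"
    "r = 0 \<longleftrightarrow> y = (\<lambda>i. if i \<in> A then - x i else 0) \<and> z = 0 \<and> x = 0"
    by (auto simp: r zero_prod_def fun_eq_iff)
  have 1: "card {s \<in> set ds. lform y x z s \<noteq> 0} =
    (if r = 0 then 0 else if r \<in> E1 then M * CARD('a) ^ CARD('n) else M * (CARD('a) ^ CARD('n) - CARD('a) ^ card B))"
    unfolding card_half y z x r0(1) E by (intro if_cong refl) auto
  have 2: "card {s \<in> set ds. lform (x + y) x z s \<noteq> 0} =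
    (if r = 0 then 0 else if r \<in> E2 then M * CARD('a) ^ CARD('n) else M * (CARD('a) ^ CARD('n) - CARD('a) ^ card B))"
    unfolding card_half xy z x r0(2) E by (intro if_cong refl) auto
  have "hwt (gray_word ds r) = card {s \<in> set ds. lform y x z s \<noteq> 0}
    + card {s \<in> set ds. lform (x + y) x z s \<noteq> 0}"
    unfolding r by (rule hwt_gray_word[OF distinct])
  then show ?thesis unfolding 1 2 by (cases "r = 0") simp_all
qed

lemma powB: "CARD('a) ^ card B < CARD('a) ^ CARD('n)"
  using q2 Bsmall by (intro power_strict_increasing) auto

lemma weights_less: "0 < d" "d < w2" "w2 < w3"
proof -
  have pB: "0 < CARD('a) ^ card B" by simp
  show "0 < d" using M_pos powB by (simp add: d_def)
  have "2 * (CARD('a) ^ CARD('n) - CARD('a) ^ card B) < 2 * CARD('a) ^ CARD('n) - CARD('a) ^ card B"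
    using powB pB by linarith
  then have "M * (2 * (CARD('a) ^ CARD('n) - CARD('a) ^ card B)) < w2"
    unfolding w2_def using M_pos by (rule mult_strict_left_mono)
  then show "d < w2" by (simp only: d_def mult.left_commute mult.assoc)
  have "2 * CARD('a) ^ CARD('n) - CARD('a) ^ card B < 2 * CARD('a) ^ CARD('n)"
    using powB pB by linarith
  then have "w2 < M * (2 * CARD('a) ^ CARD('n))"
    unfolding w2_def using M_pos by (rule mult_strict_left_mono)
  then show "w2 < w3" by (simp only: w3_def mult.left_commute mult.assoc)
qed

text \<open>The weight records how many of \<open>E1\<close> and \<open>E2\<close> contain a nonzero
  \<open>r\<close>: none gives \<open>d\<close>, one gives \<open>w2\<close>, both give
  \<open>w3\<close>.\<close>

lemma hwt_cases:
  assumes "r \<in> params"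
  shows "hwt (gray_word ds r) = (if r = 0 then 0 else if r \<in> E1 \<inter> E2 then w3
    else if r \<in> E1 \<union> E2 then w2 else d)"
proof -
  have "w2 = M * CARD('a) ^ CARD('n) + M * (CARD('a) ^ CARD('n) - CARD('a) ^ card B)"
  proof -
    have "2 * CARD('a) ^ CARD('n) - CARD('a) ^ card B
        = CARD('a) ^ CARD('n) + (CARD('a) ^ CARD('n) - CARD('a) ^ card B)"
      using powB by linarith
    then show ?thesis by (simp only: w2_def distrib_left)
  qed
  then show ?thesis
    unfolding hwt_params[OF assms] by (auto simp: w3_def d_def)
qed

lemma zero_in: "0 \<in> params" "0 \<in> E1" "0 \<in> E2"
  by (auto simp: params_def E1_def E2_def zero_prod_def Delta_def supp_def image_iff fun_eq_iff
      intro!: exI[of _ "0 :: 'n \<Rightarrow> 'a"])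

lemma E_subset: "E1 \<subseteq> params" "E2 \<subseteq> params"
  by (auto simp: params_def E1_def E2_def Delta_def supp_def split: if_splits)

lemma card_Compl_index: "card (- S) = CARD('n) - card S" for S :: "'n set"
  by (simp add: Compl_eq_Diff_UNIV card_Diff_subset)

text \<open>\<open>E2\<close> is a graph over \<open>Delta (- B)\<close>. In the intersection
  \<open>y\<close> is both 0 and \<open>- x\<close> on \<open>A\<close>, so \<open>x\<close>
  vanishes on \<open>A\<close> as well as on \<open>B\<close>.\<close>

lemma card_E: "card E1 = CARD('a) ^ (CARD('n) - card B)" "card E2 = CARD('a) ^ (CARD('n) - card B)"
  "card (E1 \<inter> E2) = CARD('a) ^ (CARD('n) - card (A \<union> B))"
proof -
  show "card E1 = CARD('a) ^ (CARD('n) - card B)"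
    by (simp add: E1_def card_cartesian_product card_Delta card_Compl_index)
  have "inj_on (\<lambda>x. (x, (\<lambda>i. if i \<in> A then - x i else 0), 0 :: 'n \<Rightarrow> 'a)) (Delta (- B) :: ('n \<Rightarrow> 'a) set)"
    by (auto simp: inj_on_def)
  then show "card E2 = CARD('a) ^ (CARD('n) - card B)"
    unfolding E2_def by (simp add: card_image card_Delta card_Compl_index)
  have "E1 \<inter> E2 = Delta (- (A \<union> B)) \<times> {0} \<times> {0}"
  proof (intro equalityI subsetI)
    fix r assume r: "r \<in> E1 \<inter> E2"
    then obtain x where x: "r = (x, (\<lambda>i. if i \<in> A then - x i else 0), 0)" "x \<in> Delta (- B)"
      and e: "(\<lambda>i. if i \<in> A then - x i else 0) = (0 :: 'n \<Rightarrow> 'a)"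
      by (auto simp: E1_def E2_def)
    have "x i = 0" if "i \<in> A" for i using fun_cong[OF e, of i] that by simp
    then have "x \<in> Delta (- (A \<union> B))" using x(2) by (auto simp: Delta_def supp_def)
    then show "r \<in> Delta (- (A \<union> B)) \<times> {0} \<times> {0}" using x(1) e by simp
  next
    fix r :: "('n, 'a) Rvec" assume "r \<in> Delta (- (A \<union> B)) \<times> {0} \<times> {0}"
    then obtain x where r: "r = (x, 0, 0)" and x: "x \<in> Delta (- (A \<union> B))" by auto
    then have "x \<in> Delta (- B)" "(\<lambda>i. if i \<in> A then - x i else 0) = 0"
      by (auto simp: Delta_def supp_def fun_eq_iff)
    then show "r \<in> E1 \<inter> E2" using r by (auto simp: E1_def E2_def image_iff)
  qed
  then show "card (E1 \<inter> E2) = CARD('a) ^ (CARD('n) - card (A \<union> B))"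
    by (simp only: card_cartesian_product card_Delta card_Compl_index) simp
qed

lemma card_params: "card params = CARD('a) ^ (CARD('n) + card A + card C)"
proof -
  have "params = Delta UNIV \<times> Delta A \<times> Delta C" by (simp add: params_def Delta_def)
  then show ?thesis by (simp add: card_cartesian_product card_Delta power_add)
qed

lemma range_gray_word: "range (gray_word ds) = gray_word ds ` params"
proof -
  have "gray_word ds r \<in> gray_word ds ` params" for r
  proof -
    obtain x y z where r: "r = (x, y, z)" by (metis prod_cases3)
    \<comment> \<open>Cutting \<open>y\<close> and \<open>z\<close> off to \<open>A\<close> and
      \<open>C\<close> does not change their products with vectors supported there.\<close>
    let ?y = "\<lambda>i. if i \<in> A then y i else 0" and ?z = "\<lambda>i. if i \<in> C then z i else 0"
    have dc: "dotp u w = dotp u' w" if "w \<in> Delta P" "\<And>i. i \<in> P \<Longrightarrow> u i = u' i"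
      for u u' w :: "'n \<Rightarrow> 'a" and P
      unfolding dotp_def using that by (intro sum.cong) (auto simp: Delta_def supp_def)
    have "lform y x z s = lform ?y x ?z s" "lform (x + y) x z s = lform (x + ?y) x ?z s"
      if s: "s \<in> set ds" for s
    proof -
      obtain w1 w2 w3 where w: "s = (w1, w2, w3)" "w1 \<in> Delta A" "w3 \<in> Delta C"
        using s unfolding set_ds by blast
      have "dotp y w1 = dotp ?y w1" "dotp (x + y) w1 = dotp (x + ?y) w1"
        by (rule dc[OF w(2)]; simp)+
      moreover have "dotp z w3 = dotp ?z w3" by (rule dc[OF w(3)]) simp
      ultimately show "lform y x z s = lform ?y x ?z s" "lform (x + y) x z s = lform (x + ?y) x ?z s"
        unfolding w(1) lform_def prod.case by (simp_all only:)
    qed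
    then have "gray_word ds r = gray_word ds (x, ?y, ?z)"
      unfolding r gray_word_def prod.case by (intro ext) simp
    moreover have "(x, ?y, ?z) \<in> params" by (auto simp: params_def Delta_def supp_def)
    ultimately show ?thesis by (rule image_eqI)
  qed
  then show ?thesis by blast
qed

text \<open>The kernel is read off from the weights: a nonzero parameter gives weight at least
  \<open>d > 0\<close>.\<close>

lemma gray_word_eq_0_iff:
  assumes "r \<in> params"
  shows "gray_word ds r = 0 \<longleftrightarrow> r = 0"
proof
  assume "gray_word ds r = 0"
  then have "hwt (gray_word ds r) = 0" by (simp add: hwt_def)
  then show "r = 0" using weights_less unfolding hwt_cases[OF assms] by (auto split: if_splits)
next
  assume "r = 0"
  moreover have "gray_word ds (0 + 0) = gray_word ds 0 + gray_word ds 0" by (rule gray_word_add)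
  ultimately show "gray_word ds r = 0" by simp
qed

lemma inj_gray_word: "inj_on (gray_word ds) params"
proof (rule inj_onI)
  fix r s assume rs: "r \<in> params" "s \<in> params" "gray_word ds r = gray_word ds s"
  have "r - s \<in> params" using rs by (auto simp: params_def Delta_diff)
  moreover have "gray_word ds (r - s) + gray_word ds s = 0 + gray_word ds s"
    unfolding gray_word_add[symmetric] diff_add_cancel add_0 by (rule rs(3))
  then have "gray_word ds (r - s) = 0" by (rule add_right_imp_eq)
  ultimately have "r - s = 0" by (simp only: gray_word_eq_0_iff)
  then show "r = s" by simp
qed

section \<open>Weight distribution\<close>

lemma wfreq_card:
  "wfreq (range (gray_word ds)) w = card {r \<in> params. r \<noteq> 0 \<and> hwt (gray_word ds r) = w}"
proof -
  have "{c \<in> range (gray_word ds). c \<noteq> 0 \<and> hwt c = w}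
    = gray_word ds ` {r \<in> params. r \<noteq> 0 \<and> hwt (gray_word ds r) = w}"
    unfolding range_gray_word by (auto simp: gray_word_eq_0_iff)
  moreover have "inj_on (gray_word ds) {r \<in> params. r \<noteq> 0 \<and> hwt (gray_word ds r) = w}"
    by (rule inj_on_subset[OF inj_gray_word]) auto
  ultimately show ?thesis by (simp only: wfreq_def card_image)
qed

text \<open>The weight classes are the complement of \<open>E1 \<union> E2\<close>, the symmetric
  difference of \<open>E1\<close> and \<open>E2\<close>, and their intersection. Zero lies in both
  sets, so only the last class loses an element.\<close>

lemma wfreq:
  "int (wfreq (range (gray_word ds)) w) =
    (if w = d then int CARD('a) ^ (CARD('n) + card A + card C) - 2 * int CARD('a) ^ (CARD('n) - card B) + int CARD('a) ^ (CARD('n) - card (A \<union> B))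
     else if w = w2 then 2 * (int CARD('a) ^ (CARD('n) - card B) - int CARD('a) ^ (CARD('n) - card (A \<union> B)))
     else if w = w3 then int CARD('a) ^ (CARD('n) - card (A \<union> B)) - 1
     else 0)"
proof -
  have U: "card (E1 \<union> E2) + CARD('a) ^ (CARD('n) - card (A \<union> B)) = 2 * CARD('a) ^ (CARD('n) - card B)"
    using card_Un_Int[of E1 E2] by (simp add: card_E)
  consider "w = d" | "w = w2" | "w = w3" | "w \<notin> {d, w2, w3}" by blast
  then show ?thesis
  proof cases
    case 1
    then have "{r \<in> params. r \<noteq> 0 \<and> hwt (gray_word ds r) = w} = params - (E1 \<union> E2)"
      using weights_less zero_in by (auto simp: hwt_cases split: if_splits)
    then have "wfreq (range (gray_word ds)) w + card (E1 \<union> E2) = card params"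
      unfolding wfreq_card using E_subset
      by (simp add: card_Diff_subset card_mono)
    then have "int (wfreq (range (gray_word ds)) w) = int (card params) - int (card (E1 \<union> E2))" by linarith
    moreover have "int (card (E1 \<union> E2)) = 2 * int CARD('a) ^ (CARD('n) - card B) - int CARD('a) ^ (CARD('n) - card (A \<union> B))"
      using arg_cong[OF U, of int] by simp
    ultimately show ?thesis using 1 by (simp add: card_params)
  next
    case 2
    then have "{r \<in> params. r \<noteq> 0 \<and> hwt (gray_word ds r) = w} = (E1 \<union> E2) - (E1 \<inter> E2)"
      using weights_less zero_in by (auto simp: hwt_cases E_subset[THEN subsetD] split: if_splits)
    then have "wfreq (range (gray_word ds)) w = card ((E1 \<union> E2) - (E1 \<inter> E2))"
      unfolding wfreq_card by (simp only:)
    also have "int \<dots> = int (card (E1 \<union> E2)) - int (card (E1 \<inter> E2))"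
      by (subst card_Diff_subset) (auto intro!: of_nat_diff card_mono)
    also have "\<dots> = 2 * (int CARD('a) ^ (CARD('n) - card B) - int CARD('a) ^ (CARD('n) - card (A \<union> B)))"
      using arg_cong[OF U, of int] by (simp add: card_E)
    finally show ?thesis using 2 weights_less by simp
  next
    case 3
    then have "{r \<in> params. r \<noteq> 0 \<and> hwt (gray_word ds r) = w} = (E1 \<inter> E2) - {0}"
      using weights_less zero_in by (auto simp: hwt_cases E_subset[THEN subsetD] split: if_splits)
    then have "wfreq (range (gray_word ds)) w = card (E1 \<inter> E2) - 1"
      unfolding wfreq_card using zero_in by (simp add: card_Diff_singleton)
    then show ?thesis using 3 weights_less q2 by (simp add: card_E of_nat_diff)
  next
    case 4
    then have "{r \<in> params. r \<noteq> 0 \<and> hwt (gray_word ds r) = w} = {}"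
      by (auto simp: hwt_cases split: if_splits)
    then show ?thesis unfolding wfreq_card using 4 by simp
  qed
qed

lemma card_AB: "card B < card (A \<union> B)" "card (A \<union> B) \<le> CARD('n)"
  using AnotB by (auto intro!: psubset_card_mono card_mono)

lemma nonzero_weights:
  "nonzero_weights (range (gray_word ds)) = (if A \<union> B = UNIV then {d, w2} else {d, w2, w3})"
proof -
  have pos: "wfreq (range (gray_word ds)) w \<noteq> 0 \<longleftrightarrow> int (wfreq (range (gray_word ds)) w) > 0" for w by simp
  have 1: "int CARD('a) ^ (CARD('n) + card A + card C) - 2 * int CARD('a) ^ (CARD('n) - card B) + int CARD('a) ^ (CARD('n) - card (A \<union> B)) > 0"
  proof -
    \<comment> \<open>The factor 2 is absorbed by one further power of \<open>q\<close>, even for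
      \<open>q = 2\<close>; the exponent has room for it since \<open>A\<close> and \<open>C\<close>
      are nonempty.\<close>
    have "2 * int CARD('a) ^ (CARD('n) - card B) \<le> int CARD('a) * int CARD('a) ^ (CARD('n) - card B)"
      using q2 by (intro mult_right_mono) auto
    also have "\<dots> = int CARD('a) ^ Suc (CARD('n) - card B)" by simp
    also have "\<dots> \<le> int CARD('a) ^ (CARD('n) + card A + card C)"
      using q2 card_pos Bsmall by (intro power_increasing) auto
    finally have "2 * int CARD('a) ^ (CARD('n) - card B) \<le> int CARD('a) ^ (CARD('n) + card A + card C)" .
    moreover have "0 < int CARD('a) ^ (CARD('n) - card (A \<union> B))" by simp
    ultimately show ?thesis by linarith
  qed
  have 2: "2 * (int CARD('a) ^ (CARD('n) - card B) - int CARD('a) ^ (CARD('n) - card (A \<union> B))) > 0"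
    using q2 card_AB by (simp add: power_strict_increasing_iff)
  have 3: "int CARD('a) ^ (CARD('n) - card (A \<union> B)) - 1 > 0 \<longleftrightarrow> A \<union> B \<noteq> UNIV"
  proof (cases "A \<union> B = UNIV")
    case False
    then have "A \<union> B \<subset> UNIV" by blast
    then have "card (A \<union> B) < CARD('n)" by (intro psubset_card_mono) simp
    then have "1 < int CARD('a) ^ (CARD('n) - card (A \<union> B))" using q2 by (intro one_less_power) auto
    then show ?thesis using False by simp
  qed simp
  have "wfreq (range (gray_word ds)) w \<noteq> 0 \<longleftrightarrow> w = d \<or> w = w2 \<or> w = w3 \<and> A \<union> B \<noteq> UNIV" for w
    unfolding pos wfreq using 1 2 3 weights_less by (auto split: if_splits)
  then show ?thesis
    unfolding nonzero_weights_wfreq[OF finite_lincode[OF lincode_gray_word]] by auto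
qed

lemma card_nonzero_weights:
  "A \<union> B = UNIV \<Longrightarrow> card (nonzero_weights (range (gray_word ds))) = 2"
  "A \<union> B \<noteq> UNIV \<Longrightarrow> card (nonzero_weights (range (gray_word ds))) = 3"
  unfolding nonzero_weights using weights_less by simp_all

section \<open>Parameters, minimality, optimality and self-orthogonality\<close>

lemma length_ds: "length ds = CARD('a) ^ (card A + card C) * (CARD('a) ^ CARD('n) - CARD('a) ^ card B)"
proof -
  have "card (DeltaC B :: ('n \<Rightarrow> 'a) set) = CARD('a) ^ CARD('n) - CARD('a) ^ card B"
    unfolding DeltaC_def by (subst card_Diff_subset) (auto simp: card_Delta card_fun)
  moreover have "length ds = card (set ds)" using distinct by (simp add: distinct_card)
  ultimately show ?thesis
    by (simp add: set_ds card_cartesian_product card_Delta power_add)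
qed

lemma is_code: "is_code (2 * length ds) (CARD('n) + card A + card C) d (range (gray_word ds))"
  unfolding is_code_def
proof (intro conjI)
  show "lincode (2 * length ds) (range (gray_word ds))" by (rule lincode_gray_word)
  \<comment> \<open>The dimension is the exponent in the number of codewords, which is unique
    because \<open>q \<ge> 2\<close>.\<close>
  have "CARD('a) ^ cdim (range (gray_word ds)) = card (range (gray_word ds))"
    by (rule card_lincode[OF lincode_gray_word, symmetric])
  also have "\<dots> = CARD('a) ^ (CARD('n) + card A + card C)"
    unfolding range_gray_word by (simp add: card_image[OF inj_gray_word] card_params)
  finally show "cdim (range (gray_word ds)) = CARD('n) + card A + card C" using q2 by simp
  show "mindist (range (gray_word ds)) = d"
    unfolding mindist_lincode[OF lincode_gray_word] nonzero_weights
    by (rule cInf_eq_minimum) (use weights_less in \<open>auto split: if_splits\<close>)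
qed

text \<open>With \<open>w3\<close> as largest weight the ratio condition amounts to
  \<open>q^(b + 1) < q^m\<close>, which fails for \<open>b = m - 1\<close>. In that case
  \<open>A \<union> B\<close> is everything, \<open>w3\<close> does not occur, and the bound with
  \<open>w2\<close> only needs \<open>q^(b + 1) \<le> q^m\<close>.\<close>

lemma minimal: "minimal_code (range (gray_word ds))"
proof (rule ashikhmin_barg[OF lincode_gray_word, where lo = d and hi = "if A \<union> B = UNIV then w2 else w3"])
  have nz: "hwt v \<in> nonzero_weights (range (gray_word ds))" if "v \<in> range (gray_word ds)" "v \<noteq> 0" for v
    using that unfolding nonzero_weights_def by blast
  show "d \<le> hwt v" if "v \<in> range (gray_word ds)" "v \<noteq> 0" for v
    using nz[OF that] weights_less unfolding nonzero_weights by (auto split: if_splits)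
  show "hwt v \<le> (if A \<union> B = UNIV then w2 else w3)" if "v \<in> range (gray_word ds)" for v
  proof (cases "v = 0")
    case False
    then show ?thesis using nz[OF that] weights_less unfolding nonzero_weights by (auto split: if_splits)
  qed (simp add: hwt_def)
  obtain p where p: "CARD('a) = Suc p" "p \<ge> 1" using q2 by (cases "CARD('a)") auto
  have pB: "0 < CARD('a) ^ card B" using q2 by simp
  show "(CARD('a) - 1) * (if A \<union> B = UNIV then w2 else w3) < CARD('a) * d"
  proof (cases "A \<union> B = UNIV")
    case True
    have "CARD('a) ^ Suc (card B) \<le> CARD('a) ^ CARD('n)" using q2 Bsmall by (intro power_increasing) auto
    then have le: "CARD('a) * CARD('a) ^ card B \<le> CARD('a) ^ CARD('n)" by simp
    \<comment> \<open>The slack in \<open>q^(b + 1) \<le> q^m\<close>; written with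
      \<open>X\<close>, both sides become free of natural subtraction.\<close>
    define X where "X = CARD('a) ^ CARD('n) - CARD('a) * CARD('a) ^ card B"
    have X: "CARD('a) ^ CARD('n) = X + CARD('a) * CARD('a) ^ card B" using le by (simp add: X_def)
    have "(CARD('a) - 1) * (2 * CARD('a) ^ CARD('n) - CARD('a) ^ card B) < CARD('a) * (2 * (CARD('a) ^ CARD('n) - CARD('a) ^ card B))"
    proof -
      have 1: "2 * CARD('a) ^ CARD('n) - CARD('a) ^ card B = 2 * X + (2 * p + 1) * CARD('a) ^ card B"
        "CARD('a) ^ CARD('n) - CARD('a) ^ card B = X + p * CARD('a) ^ card B"
        unfolding X by (simp_all add: p(1))
      show ?thesis unfolding 1 using pB p(2) by (simp add: p(1) algebra_simps)
    qed
    then have "M * ((CARD('a) - 1) * (2 * CARD('a) ^ CARD('n) - CARD('a) ^ card B)) < M * (CARD('a) * (2 * (CARD('a) ^ CARD('n) - CARD('a) ^ card B)))"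
      using M_pos by simp
    then show ?thesis using True by (simp add: w2_def d_def mult_ac)
  next
    case False
    then have "A \<union> B \<subset> UNIV" by blast
    then have "card (A \<union> B) < CARD('n)" by (intro psubset_card_mono) simp
    then have "CARD('a) ^ Suc (card B) < CARD('a) ^ CARD('n)" using q2 card_AB by (intro power_strict_increasing) auto
    then have "CARD('a) * CARD('a) ^ card B < CARD('a) ^ CARD('n)" by simp
    then have "(CARD('a) - 1) * CARD('a) ^ CARD('n) < CARD('a) * (CARD('a) ^ CARD('n) - CARD('a) ^ card B)"
      by (simp add: diff_mult_distrib diff_mult_distrib2 p)
    then have "2 * M * ((CARD('a) - 1) * CARD('a) ^ CARD('n)) < 2 * M * (CARD('a) * (CARD('a) ^ CARD('n) - CARD('a) ^ card B))"
      using M_pos by simp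
    then show ?thesis using False by (simp add: w3_def d_def mult_ac)
  qed
qed

text \<open>The shape needed for \<open>griesmer_sum\<close> with \<open>k = m + a + c\<close> and
  \<open>t = a + b + c\<close>; it also shows the divisor \<open>q^(t - 1)\<close> of
  \<open>d\<close>.\<close>

lemma d_eq: "d = 2 * (CARD('a) - 1) * (CARD('a) ^ (CARD('n) + card A + card C - 1) - CARD('a) ^ (card A + card B + card C - 1))"
proof -
  have e: "CARD('n) + card A + card C - 1 = (card A + card C - 1) + CARD('n)"
    "card A + card B + card C - 1 = (card A + card C - 1) + card B" using card_pos by auto
  have "2 * (p * P) * (X - Y) = 2 * p * (P * X - P * Y)" for p P X Y :: nat
    by (simp only: diff_mult_distrib2[symmetric] mult_ac)
  then show ?thesis unfolding e d_def M_def power_add .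
qed

lemma length_eq: "2 * length ds = 2 * (CARD('a) ^ (CARD('n) + card A + card C) - CARD('a) ^ (card A + card B + card C))"
  by (simp add: length_ds power_add diff_mult_distrib2 mult_ac)

lemma near_griesmer: "near_griesmer CARD('a) (2 * length ds) (CARD('n) + card A + card C) d"
  unfolding near_griesmer_def d_eq length_eq
  by (rule griesmer_sum) (use q2 card_pos Bsmall in auto)

text \<open>The Griesmer sum for \<open>d\<close> is one below the length, while passing to
  \<open>d + 1\<close> adds at least \<open>a + b + c\<close>, which is at least 3.\<close>

lemma optimal: "distance_optimal (2 * length ds) (CARD('n) + card A + card C) d (range (gray_word ds))"
  unfolding distance_optimal_def
proof
  let ?k = "CARD('n) + card A + card C" and ?t = "card A + card B + card C"
  assume "\<exists>C' :: (nat \<Rightarrow> 'a) set. is_code (2 * length ds) ?k (d + 1) C'"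
  then obtain C' :: "(nat \<Rightarrow> 'a) set" where lin: "lincode (2 * length ds) C'"
    and dim: "cdim C' = ?k" and md: "mindist C' = d + 1"
    unfolding is_code_def by blast
  have "(\<Sum>i<?k. nat \<lceil>(real d + 1) / real CARD('a) ^ i\<rceil>) \<le> card {..<2 * length ds}"
  proof (rule griesmer_bound)
    show "finite {..<2 * length ds}" by simp
    show "supp v \<subseteq> {..<2 * length ds}" if "v \<in> C'" for v by (rule supp_lincode[OF lin that])
    show "x + y \<in> C'" if "x \<in> C'" "y \<in> C'" for x y using lin that by (simp only: lincode_def)
    show "(\<lambda>j. \<alpha> * x j) \<in> C'" if "x \<in> C'" for \<alpha> x
      using lin that unfolding lincode_def fscale_def by blast
    show "card C' = CARD('a) ^ ?k" using card_lincode[OF lin] dim by simp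
    show "real d + 1 \<le> real (card (supp v))" if "v \<in> C'" "v \<noteq> 0" for v
    proof -
      have "hwt v \<in> nonzero_weights C'" using that unfolding nonzero_weights_def by blast
      then have "d + 1 \<le> hwt v" using md unfolding mindist_lincode[OF lin]
        by (metis cInf_lower bdd_below_bot)
      then show ?thesis by (simp add: hwt_eq_card_supp)
    qed
  qed
  moreover have "CARD('a) ^ (?t - 1) dvd d"
    unfolding d_eq by (intro dvd_mult dvd_diff_nat le_imp_power_dvd) (use Bsmall in auto)
  then have "(\<Sum>i<?k. nat \<lceil>real d / real CARD('a) ^ i\<rceil>) + ?t \<le> (\<Sum>i<?k. nat \<lceil>(real d + 1) / real CARD('a) ^ i\<rceil>)"
    by (intro griesmer_sum_Suc q2) (use Bsmall in auto)
  moreover have "(\<Sum>i<?k. nat \<lceil>real d / real CARD('a) ^ i\<rceil>) = 2 * length ds - 1"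
    using near_griesmer by (simp only: near_griesmer_def)
  ultimately show False using card_pos by simp
qed

text \<open>\<open>q\<close> divides \<open>M\<close> because \<open>a + c - 1\<close> is at least
  1. For \<open>q = 2\<close> a second factor 2 is explicit in \<open>d\<close> and
  \<open>w3\<close>, and in \<open>w2\<close> it comes from \<open>2 * q^m - q^b\<close> with
  \<open>b\<close> positive.\<close>

lemma self_orthogonal:
  assumes "CARD('a) \<in> {2, 3}"
  shows "self_orthogonal (2 * length ds) (range (gray_word ds))"
proof -
  let ?g = "if CARD('a) = 2 then 4 else CARD('a)"
  have "Suc 0 \<le> card A + card C - 1" using card_pos by simp
  then have "CARD('a) ^ 1 dvd CARD('a) ^ (card A + card C - 1)" by (intro le_imp_power_dvd) simp
  then have qM: "CARD('a) dvd M" by (simp add: M_def)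
  have "CARD('a) dvd CARD('a) ^ card B" "CARD('a) dvd CARD('a) ^ CARD('n)" using card_pos by (simp_all add: dvd_power)
  then have "CARD('a) * CARD('a) dvd w2" if "CARD('a) = 2"
    unfolding w2_def using qM by (intro mult_dvd_mono dvd_diff_nat dvd_mult)
  moreover have "CARD('a) * CARD('a) dvd d" "CARD('a) * CARD('a) dvd w3" if "CARD('a) = 2"
    using mult_dvd_mono[OF dvd_refl[of 2] qM] that unfolding d_def w3_def by auto
  moreover have "CARD('a) dvd d" "CARD('a) dvd w2" "CARD('a) dvd w3" using qM by (simp_all add: d_def w2_def w3_def)
  ultimately have dv: "?g dvd d" "?g dvd w2" "?g dvd w3" by auto
  have wt: "?g dvd hwt v" if v: "v \<in> range (gray_word ds)" for v
  proof -
    obtain r where r: "r \<in> params" "v = gray_word ds r" using v unfolding range_gray_word by blast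
    show ?thesis unfolding r(2) hwt_cases[OF r(1)] using dv by auto
  qed
  from assms consider "CARD('a) = 2" | "CARD('a) = 3" by blast
  then show ?thesis
  proof cases
    case 1
    show ?thesis by (rule self_orthogonal_binary[OF 1 lincode_gray_word]) (use wt 1 in simp)
  next
    case 2
    show ?thesis by (rule self_orthogonal_ternary[OF 2 lincode_gray_word]) (use wt 2 in simp)
  qed
qed

end

section \<open>The code of the theorem as an instance of \<open>defining_set\<close>\<close>

theorem mainTheorem7:
  fixes A B C :: "'n::finite set"
    and ds :: "('n, 'a::{field,finite}) Rvec list"
  assumes m2: "CARD('n) \<ge> 2"
    and nA: "A \<noteq> {}" and nB: "B \<noteq> {}" and nC: "C \<noteq> {}"
    and Bsmall: "card B < CARD('n)"
    and AnotB: "\<not> A \<subseteq> B"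
    and ds: "distinct ds"
    and S3: "set ds = {(w1, w2, w3). w1 \<in> Delta A \<and> w2 \<in> DeltaC B \<and> w3 \<in> Delta C}"
  shows
   "let q = CARD('a); m = CARD('n); a = card A; b = card B; c = card C; ab = card (A \<union> B);
        Phi = gray (length ds) ` codeD ds;
        n = 2 * q ^ (a + c) * (q ^ m - q ^ b);
        k = m + a + c;
        d = 2 * (q - 1) * q ^ (a + c - 1) * (q ^ m - q ^ b);
        w2 = (q - 1) * q ^ (a + c - 1) * (2 * q ^ m - q ^ b);
        w3 = 2 * (q - 1) * q ^ (m + a + c - 1)
    in is_code n k d Phi
    \<and> (\<forall>w. int (wfreq Phi w) =
          (if w = d then int q ^ (m + a + c) - 2 * int q ^ (m - b) + int q ^ (m - ab)
           else if w = w2 then 2 * (int q ^ (m - b) - int q ^ (m - ab))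
           else if w = w3 then int q ^ (m - ab) - 1
           else 0))
    \<and> minimal_code Phi
    \<and> near_griesmer q n k d
    \<and> distance_optimal n k d Phi
    \<and> (q \<in> {2, 3} \<longrightarrow> self_orthogonal n Phi)
    \<and> (A \<union> B = UNIV \<longrightarrow> card (nonzero_weights Phi) = 2)
    \<and> (A \<union> B \<noteq> UNIV \<longrightarrow> card (nonzero_weights Phi) = 3)"
proof -
  let ?q = "CARD('a)" and ?m = "CARD('n)" and ?a = "card A" and ?b = "card B" and ?c = "card C"
  let ?M = "(?q - 1) * ?q ^ (?a + ?c - 1)"
  have "0 < ?a" using nA by (simp add: card_gt_0_iff)
  \<comment> \<open>Regrouping the truncated exponent is what identifies the stated third weight
    with \<open>2 * M * q^m\<close>.\<close>
  then have e: "?m + ?a + ?c - 1 = (?a + ?c - 1) + ?m" by simp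
  interpret S: defining_set A B C ds ?M "2 * (?q - 1) * ?q ^ (?a + ?c - 1) * (?q ^ ?m - ?q ^ ?b)"
    "?M * (2 * ?q ^ ?m - ?q ^ ?b)" "2 * (?q - 1) * ?q ^ (?m + ?a + ?c - 1)"
  proof
    show "set ds = Delta A \<times> DeltaC B \<times> Delta C" unfolding S3 by auto
    show "2 * (?q - 1) * ?q ^ (?m + ?a + ?c - 1) = 2 * ?M * ?q ^ ?m"
      unfolding e by (simp only: power_add mult.assoc)
  qed (fact nA nB nC Bsmall AnotB ds | simp only: mult.assoc)+
  have n: "2 * ?q ^ (?a + ?c) * (?q ^ ?m - ?q ^ ?b) = 2 * length ds"
    by (simp only: S.length_ds mult.assoc)
  show ?thesis
    unfolding Let_def n gray_codeD
    by (intro conjI allI impI S.is_code S.wfreq S.minimal S.near_griesmer S.optimal S.self_orthogonal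
        S.card_nonzero_weights)
qed

end
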